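(* Let $X_i$, $i\ge 1$, be extended negatively orthant dependent (ENOD) random variables with common distribution $F\in\mathcal{D}$ on $(-\infty,\infty)$, and let $S_n=\sum_{k=1}^n X_k$. If $E|X_1|<\infty$ and $F(-x)=o\big(\overline{F}(x)\big)$ as $x\to\infty$, then for each $\gamma>0$, $$L_F\le\liminf_{n\to\infty}\inf_{x\ge\gamma n}\frac{P(S_n>x)}{n\overline{F}(x)}\le\limsup_{n\to\infty}\sup_{x\ge\gamma n}\frac{P(S_n>x)}{n\overline{F}(x)}\le L_F^{-1}.$$ In particular, if $F\in\mathcal{C}$, then for each $\gamma>0$, $$\lim_{n\to\infty}\sup_{x\ge\gamma n}\Big|\frac{P(S_n>x)}{n\overline{F}(x)}-1\Big|=0.$$
   Context: For a distribution $F$, $\overline F=1-F$ is its tail (assumed positive everywhere when ratios of tails are taken). For $y>0$ put $\overline F_*(y)=\liminf_{x\to\infty}\overline F(xy)/\overline F(x)$ and $\overline F^*(y)=\limsup_{x\to\infty}\overline F(xy)/\overline F(x)$, and $L_F=\lim_{y\downarrow 1}\overline F_*(y)$. The dominatedly varying tailed class is $\mathcal D=\{F:\overline F^*(y)<\infty\text{ for each }y>1\}$; the consistently varying tailed class is $\mathcal C=\{F:L_F=1\}$ (so $\mathcal C\subset\mathcal D$). Random variables $X_i$, $i\ge1$, are ENOD if there is a constant $M>0$ such that for every $n\ge1$ and all real $x_1,\dots,x_n$, both $P\big(\bigcap_{i=1}^n\{X_i>x_i\}\big)\le M\prod_{i=1}^nP(X_i>x_i)$ and $P\big(\bigcap_{i=1}^n\{X_i\le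 x_i\}\big)\le M\prod_{i=1}^nP(X_i\le x_i)$.
   Formalization: The formal theorem adds the hypothesis E X_1 = 0, without which the claim fails (e.g. i.i.d. Pareto with mean 2), and defines the class D by finiteness of the upper tail ratio for 0<y<1 instead of y>1, where it always holds; outside this D, L_F=0 and the bounds are trivial. *)

theory Defs
  imports "HOL-Probability.Probability"
begin

text \<open>A distribution on the real line is a probability measure \<^term>\<open>F :: real measure\<close>;
  its distribution function is \<^term>\<open>cdf F\<close>.\<close>

definition tail :: "real measure \<Rightarrow> real \<Rightarrow> real" where
  "tail F x = 1 - cdf F x"

definition tail_liminf :: "real measure \<Rightarrow> real \<Rightarrow> ereal" where
  "tail_liminf F y = Liminf at_top (\<lambda>x. ereal (tail F (x * y) / tail F x))"

definition tail_limsup :: "real measure \<Rightarrow> real \<Rightarrow> ereal" where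
  "tail_limsup F y = Limsup at_top (\<lambda>x. ereal (tail F (x * y) / tail F x))"

text \<open>The one-sided limit exists for every distribution with positive tail, because
  \<^term>\<open>tail_liminf F\<close> is then antimonotone on the positive half-line.\<close>

definition L_index :: "real measure \<Rightarrow> ereal" where
  "L_index F = Lim (at_right 1) (tail_liminf F)"

text \<open>The limsup condition must range over \<open>0 < y < 1\<close>: for \<open>y > 1\<close> the ratio of tails is
  eventually at most 1, so finiteness there holds for every distribution with positive tail
  (see \<open>tail_limsup_le_1\<close>).\<close>

definition dominatedly_varying :: "real measure set" where
  "dominatedly_varying = {F. real_distribution F \<and> (\<forall>x. 0 < tail F x) \<and>
     (\<forall>y. 0 < y \<and> y < 1 \<longrightarrow> tail_limsup F y < \<infinity>)}"

definition consistently_varying :: "real measure set" where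
  "consistently_varying = {F. real_distribution F \<and> (\<forall>x. 0 < tail F x) \<and> L_index F = 1}"

lemma tail_limsup_le_1:
  assumes "real_distribution F" and "\<And>x. 0 < tail F x" and "1 \<le> y"
  shows "tail_limsup F y \<le> 1"
proof -
  interpret real_distribution F by fact
  have "eventually (\<lambda>x. ereal (tail F (x * y) / tail F x) \<le> 1) at_top"
    using eventually_ge_at_top[of 0]
  proof eventually_elim
    case (elim x)
    have "x \<le> x * y" using elim assms(3) by (simp add: mult_le_cancel_left1)
    then have "cdf F x \<le> cdf F (x * y)" by (rule cdf_nondecreasing)
    then show ?case using assms(2)[of x] by (simp add: tail_def)
  qed
  then show ?thesis unfolding tail_limsup_def by (rule Limsup_bounded)
qed

text \<open>Extended negative orthant dependence of the sequence \<open>X 1, X 2, \<dots>\<close>; the value \<open>X 0\<close> is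
  irrelevant.\<close>

definition ENOD :: "'a measure \<Rightarrow> (nat \<Rightarrow> 'a \<Rightarrow> real) \<Rightarrow> bool" where
  "ENOD M X \<longleftrightarrow> (\<forall>i\<ge>1. X i \<in> borel_measurable M) \<and>
     (\<exists>C>0. \<forall>n\<ge>1. \<forall>x :: nat \<Rightarrow> real.
        measure M {\<omega> \<in> space M. \<forall>i\<in>{1..n}. X i \<omega> > x i}
          \<le> C * (\<Prod>i=1..n. measure M {\<omega> \<in> space M. X i \<omega> > x i}) \<and>
        measure M {\<omega> \<in> space M. \<forall>i\<in>{1..n}. X i \<omega> \<le> x i}
          \<le> C * (\<Prod>i=1..n. measure M {\<omega> \<in> space M. X i \<omega> \<le> x i}))"

definition ratio :: "'a measure \<Rightarrow> (nat \<Rightarrow> 'a \<Rightarrow> real) \<Rightarrow> real measure \<Rightarrow> nat \<Rightarrow> real \<Rightarrow> real" where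
  "ratio M X F n x =
     measure M {\<omega> \<in> space M. (\<Sum>k=1..n. X k \<omega>) > x} / (real n * tail F x)"

end

theory Submission
  imports Defs "HOL-Real_Asymp.Real_Asymp"
begin

text \<open>
The theorem is an instance of the principle of a single big jump: for \<open>x \<ge> \<gamma> * n\<close> the sum
\<open>S = X 1 + \<dots> + X n\<close> exceeds \<open>x\<close> essentially only if one summand does, which happens with probability
about \<open>n * tail F x\<close>.  The loss between the levels \<open>x\<close> and \<open>x * y\<close>, with \<open>y\<close> slightly above 1, is
measured by \<open>L_index F\<close>.  All estimates hold for large \<open>x\<close>, uniformly in \<open>n \<le> x / \<gamma>\<close>; integrability
of \<open>F\<close> enters through \<open>x * tail F x \<longlongrightarrow> 0\<close>, which makes \<open>n * tail F x\<close> uniformly small.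

For the upper bound (\<open>eventually_sum_tail_le\<close>), \<open>S > x\<close> forces a summand above \<open>x / y\<close>, or two
summands above \<open>v * x\<close>, or a large value of the sum of the variables clipped at \<open>v * x\<close>.  For the lower
bound (\<open>eventually_sum_tail_ge\<close>), a summand above \<open>x * y\<close> makes \<open>S > x\<close> unless some summand is below
\<open>- v * x\<close>, which the assumption on the left tail excludes, or the sum of the clipped variables \<open>- X i\<close> is
large.  Two large summands have a probability of order \<open>(n * tail F x)\<^sup>2\<close> by orthant dependence.

The core is therefore that sums of clipped variables are negligible (\<open>truncated_sum_negligible\<close>),
applied both to \<open>X\<close> and to \<open>- X\<close>.  This is a Chernoff bound.  Orthant dependence bounds the exponential
moment of the sum by \<open>C\<close> times the product of the exponential moments
(\<open>upper_orthant_dominated_nn_integral_prod\<close>), as clipping and the exponential function are nondecreasing.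
Only a first moment is assumed, so the exponent must be adapted to the tail: it is chosen
as \<open>- ln (n * tail F (v * x)) / (2 * v * x)\<close>, and dominated variation, which makes the tail comparable
at different scales up to a polynomial factor, then yields a bound of order \<open>(n * tail F x)\<^sup>2\<close>.
\<close>

section \<open>Orthant domination\<close>

text \<open>The inequality is required for all subfamilies \<open>J\<close> of \<open>I\<close>, which amounts to admitting thresholds
\<open>-\<infinity>\<close>.  In this form the condition also controls pairs of variables and is inherited by every
continuous nondecreasing transformation of the variables.\<close>

definition upper_orthant_dominated ::
    "'a measure \<Rightarrow> real \<Rightarrow> 'i set \<Rightarrow> ('i \<Rightarrow> 'a \<Rightarrow> real) \<Rightarrow> bool" where
  "upper_orthant_dominated M C I Y \<longleftrightarrow>
     (\<forall>i\<in>I. Y i \<in> borel_measurable M) \<and>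
     (\<forall>J\<subseteq>I. \<forall>y. measure M {\<omega> \<in> space M. \<forall>i\<in>J. Y i \<omega> > y i}
        \<le> C * (\<Prod>i\<in>J. measure M {\<omega> \<in> space M. Y i \<omega> > y i}))"

lemma (in prob_space) prob_Ball_Union_le:
  fixes A :: "'i \<Rightarrow> nat \<Rightarrow> 'a set"
  assumes "finite I" and A: "\<And>i m. i \<in> I \<Longrightarrow> A i m \<in> events"
    and inc: "\<And>i. i \<in> I \<Longrightarrow> incseq (A i)"
    and bound: "\<And>m. prob {\<omega> \<in> space M. \<forall>i\<in>I. \<omega> \<in> A i m} \<le> B"
  shows "prob {\<omega> \<in> space M. \<forall>i\<in>I. \<exists>m. \<omega> \<in> A i m} \<le> B"
proof -
  let ?E = "\<lambda>m. {\<omega> \<in> space M. \<forall>i\<in>I. \<omega> \<in> A i m}"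
  have meas: "range ?E \<subseteq> events"
    using A \<open>finite I\<close> by (auto intro!: sets.sets_Collect_finite_All' sets.sets_Collect_finite_All
        simp: Collect_conj_eq)
  have incE: "incseq ?E"
    using inc by (fastforce simp: incseq_def)
  have "(\<Union>m. ?E m) = {\<omega> \<in> space M. \<forall>i\<in>I. \<exists>m. \<omega> \<in> A i m}"
  proof (intro subset_antisym subsetI)
    fix \<omega> assume "\<omega> \<in> {\<omega> \<in> space M. \<forall>i\<in>I. \<exists>m. \<omega> \<in> A i m}"
    then have \<omega>: "\<omega> \<in> space M" "\<forall>i\<in>I. \<exists>m. \<omega> \<in> A i m" by auto
    have "\<forall>i\<in>I. \<forall>\<^sub>F m in sequentially. \<omega> \<in> A i m"
      using \<omega>(2) inc by (auto simp: eventually_sequentially incseq_def) blast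
    then have "\<forall>\<^sub>F m in sequentially. \<forall>i\<in>I. \<omega> \<in> A i m"
      using \<open>finite I\<close> by (simp add: eventually_ball_finite)
    then show "\<omega> \<in> (\<Union>m. ?E m)"
      using \<omega>(1) by (auto simp: eventually_sequentially)
  qed auto
  with finite_Lim_measure_incseq[OF meas incE]
  have "(\<lambda>m. prob (?E m)) \<longlonglongrightarrow> prob {\<omega> \<in> space M. \<forall>i\<in>I. \<exists>m. \<omega> \<in> A i m}"
    by simp
  then show ?thesis
    by (rule LIMSEQ_le_const2) (use bound in auto)
qed

text \<open>A subfamily is reached from the full initial segment by sending the remaining thresholds to
\<open>-\<infinity>\<close>.  For the negated variables the lower orthants of \<open>X\<close> provide the bound with non-strict
inequalities, and the strict ones are increasing unions of these.  In both cases continuity from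
below of the measure applies.\<close>

lemma (in prob_space) ENOD_imp_upper_orthant_dominated:
  assumes "ENOD M X"
  obtains C where "C > 0"
    and "\<And>n. upper_orthant_dominated M C {1..n} X"
    and "\<And>n. upper_orthant_dominated M C {1..n} (\<lambda>i \<omega>. - X i \<omega>)"
proof -
  have X[measurable]: "X i \<in> borel_measurable M" if "i \<ge> 1" for i
    using assms that by (auto simp: ENOD_def)
  obtain C where C: "C > 0"
    and up: "\<And>n x. n \<ge> 1 \<Longrightarrow> prob {\<omega> \<in> space M. \<forall>i\<in>{1..n}. X i \<omega> > x i}
          \<le> C * (\<Prod>i=1..n. prob {\<omega> \<in> space M. X i \<omega> > x i})"
    and lo: "\<And>n x. n \<ge> 1 \<Longrightarrow> prob {\<omega> \<in> space M. \<forall>i\<in>{1..n}. X i \<omega> \<le> x i}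
          \<le> C * (\<Prod>i=1..n. prob {\<omega> \<in> space M. X i \<omega> \<le> x i})"
    using assms unfolding ENOD_def by blast
  have prod_le: "(\<Prod>i\<in>{1..n}. prob (A i)) \<le> (\<Prod>i\<in>J. prob (B i))"
    if "J \<subseteq> {1..n}" "\<And>i. i \<in> J \<Longrightarrow> prob (A i) \<le> prob (B i)"
    for J n and A B :: "nat \<Rightarrow> 'a set"
  proof -
    have "(\<Prod>i\<in>{1..n}. prob (A i)) \<le> (\<Prod>i\<in>{1..n}. if i \<in> J then prob (B i) else 1)"
      by (rule prod_mono) (use that in auto)
    also have "\<dots> = (\<Prod>i\<in>J. prob (B i))"
      using that(1) by (simp add: prod.If_cases Int_absorb1)
    finally show ?thesis .
  qed
  have U: "prob {\<omega> \<in> space M. \<forall>i\<in>J. X i \<omega> > y i} \<le> C * (\<Prod>i\<in>J. prob {\<omega> \<in> space M. X i \<omega> > y i})"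
    if J: "J \<subseteq> {1..n}" and n: "n \<ge> 1" for J n y
  proof -
    define z where "z m i = (if i \<in> J then y i else - real m)" for m i
    have eq: "{\<omega> \<in> space M. \<forall>i\<in>{1..n}. \<exists>m. \<omega> \<in> {\<omega>\<in>space M. X i \<omega> > z m i}}
        = {\<omega> \<in> space M. \<forall>i\<in>J. X i \<omega> > y i}"
      (is "?l = ?r")
    proof (intro subset_antisym subsetI)
      fix \<omega> assume \<omega>: "\<omega> \<in> ?l"
      have "X i \<omega> > y i" if "i \<in> J" for i
      proof -
        have "i \<in> {1..n}" using that J by auto
        then obtain m where "X i \<omega> > z m i" using \<omega> by blast
        then show ?thesis using that by (auto simp: z_def)
      qed
      then show "\<omega> \<in> ?r" using \<omega> n by auto
    next
      fix \<omega> assume \<omega>: "\<omega> \<in> ?r"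
      have "\<exists>m. X i \<omega> > z m i" for i
      proof (cases "i \<in> J")
        case True
        then show ?thesis using \<omega> by (auto simp: z_def)
      next
        case False
        obtain m where "- X i \<omega> < real m" using reals_Archimedean2 by blast
        then have "X i \<omega> > z m i" using False by (simp add: z_def)
        then show ?thesis ..
      qed
      then show "\<omega> \<in> ?l" using \<omega> by auto
    qed
    have "prob {\<omega> \<in> space M. \<forall>i\<in>{1..n}. \<exists>m. \<omega> \<in> {\<omega>\<in>space M. X i \<omega> > z m i}}
       \<le> C * (\<Prod>i\<in>J. prob {\<omega> \<in> space M. X i \<omega> > y i})"
    proof (rule prob_Ball_Union_le)
      fix m
      have "prob {\<omega> \<in> space M. \<forall>i\<in>{1..n}. \<omega> \<in> {\<omega>\<in>space M. X i \<omega> > z m i}}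
        = prob {\<omega> \<in> space M. \<forall>i\<in>{1..n}. X i \<omega> > z m i}"
        by (rule arg_cong[of _ _ prob]) auto
      also have "\<dots> \<le> C * (\<Prod>i=1..n. prob {\<omega> \<in> space M. X i \<omega> > z m i})"
        using up[OF n] .
      also have "\<dots> \<le> C * (\<Prod>i\<in>J. prob {\<omega> \<in> space M. X i \<omega> > y i})"
        using C by (intro mult_left_mono prod_le J) (auto simp: z_def)
      finally show "prob {\<omega> \<in> space M. \<forall>i\<in>{1..n}. \<omega> \<in> {\<omega>\<in>space M. X i \<omega> > z m i}}
        \<le> C * (\<Prod>i\<in>J. prob {\<omega> \<in> space M. X i \<omega> > y i})" .
    qed (auto simp: incseq_def z_def)
    then show ?thesis unfolding eq .
  qed
  have L: "prob {\<omega> \<in> space M. \<forall>i\<in>J. - X i \<omega> > y i} \<le> C * (\<Prod>i\<in>J. prob {\<omega> \<in> space M. - X i \<omega> > y i})"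
    if J: "J \<subseteq> {1..n}" and n: "n \<ge> 1" for J n y
  proof -
    define z where "z m i = (if i \<in> J then - y i - 1 / real (Suc m) else real m)" for m i
    have mono: "z m i \<le> z m' i" if "m \<le> m'" for m m' i
      using that by (auto simp: z_def frac_le)
    have ex: "\<exists>m. x \<le> - y - 1 / real (Suc m)" if "- x > y" for x y :: real
      using reals_Archimedean[of "- x - y"] that by (auto simp: inverse_eq_divide) (smt (verit))
    have lt: "x < - y" if "x \<le> - y - 1 / real (Suc m)" for x y :: real and m
    proof -
      have "0 < 1 / real (Suc m)" by simp
      then show ?thesis using that by linarith
    qed
    have eq: "{\<omega> \<in> space M. \<forall>i\<in>{1..n}. \<exists>m. \<omega> \<in> {\<omega>\<in>space M. X i \<omega> \<le> z m i}}
        = {\<omega> \<in> space M. \<forall>i\<in>J. - X i \<omega> > y i}" (is "?l = ?r")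
    proof (intro subset_antisym subsetI)
      fix \<omega> assume \<omega>: "\<omega> \<in> ?l"
      have "- X i \<omega> > y i" if "i \<in> J" for i
      proof -
        have "i \<in> {1..n}" using that J by auto
        then obtain m where "X i \<omega> \<le> z m i" using \<omega> by blast
        then show ?thesis using that lt[of "X i \<omega>" "y i" m] by (auto simp: z_def)
      qed
      then show "\<omega> \<in> ?r" using \<omega> by auto
    next
      fix \<omega> assume \<omega>: "\<omega> \<in> ?r"
      have "\<exists>m. X i \<omega> \<le> z m i" for i
        using \<omega> ex[of "y i" "X i \<omega>"] real_arch_simple[of "X i \<omega>"] by (cases "i \<in> J") (auto simp: z_def)
      then show "\<omega> \<in> ?l" using \<omega> by auto
    qed
    have "prob {\<omega> \<in> space M. \<forall>i\<in>{1..n}. \<exists>m. \<omega> \<in> {\<omega>\<in>space M. X i \<omega> \<le> z m i}}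
       \<le> C * (\<Prod>i\<in>J. prob {\<omega> \<in> space M. - X i \<omega> > y i})"
    proof (rule prob_Ball_Union_le)
      fix m
      have "prob {\<omega> \<in> space M. \<forall>i\<in>{1..n}. \<omega> \<in> {\<omega>\<in>space M. X i \<omega> \<le> z m i}}
        = prob {\<omega> \<in> space M. \<forall>i\<in>{1..n}. X i \<omega> \<le> z m i}"
        by (rule arg_cong[of _ _ prob]) auto
      also have "\<dots> \<le> C * (\<Prod>i=1..n. prob {\<omega> \<in> space M. X i \<omega> \<le> z m i})"
        using lo[OF n] .
      also have "\<dots> \<le> C * (\<Prod>i\<in>J. prob {\<omega> \<in> space M. - X i \<omega> > y i})"
      proof (intro mult_left_mono prod_le J finite_measure_mono)
        fix i assume i: "i \<in> J"
        then have "i \<ge> 1" using J by auto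
        note X[OF this, measurable]
        show "{\<omega> \<in> space M. - X i \<omega> > y i} \<in> events" by measurable
        show "{\<omega> \<in> space M. X i \<omega> \<le> z m i} \<subseteq> {\<omega> \<in> space M. - X i \<omega> > y i}"
          using i lt[of "X i _" "y i" m] by (fastforce simp: z_def)
      qed (use C in auto)
      finally show "prob {\<omega> \<in> space M. \<forall>i\<in>{1..n}. \<omega> \<in> {\<omega>\<in>space M. X i \<omega> \<le> z m i}}
        \<le> C * (\<Prod>i\<in>J. prob {\<omega> \<in> space M. - X i \<omega> > y i})" .
    next
      fix i assume "i \<in> {1..n}"
      show "incseq (\<lambda>m. {\<omega>\<in>space M. X i \<omega> \<le> z m i})"
        unfolding incseq_def using mono[of _ _ i] order_trans by blast
    qed auto
    then show ?thesis unfolding eq .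
  qed
  have "upper_orthant_dominated M C {1..n} X" for n
    unfolding upper_orthant_dominated_def
  proof (intro conjI ballI allI impI)
    fix J y assume "J \<subseteq> {1..n}"
    then have "J \<subseteq> {1..max 1 n}" by fastforce
    then show "prob {\<omega> \<in> space M. \<forall>i\<in>J. X i \<omega> > y i}
        \<le> C * (\<Prod>i\<in>J. prob {\<omega> \<in> space M. X i \<omega> > y i})"
      by (rule U) simp
  qed auto
  moreover have "upper_orthant_dominated M C {1..n} (\<lambda>i \<omega>. - X i \<omega>)" for n
    unfolding upper_orthant_dominated_def
  proof (intro conjI ballI allI impI)
    fix J y assume "J \<subseteq> {1..n}"
    then have "J \<subseteq> {1..max 1 n}" by fastforce
    then show "prob {\<omega> \<in> space M. \<forall>i\<in>J. - X i \<omega> > y i}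
        \<le> C * (\<Prod>i\<in>J. prob {\<omega> \<in> space M. - X i \<omega> > y i})"
      by (rule L) simp
  qed auto
  ultimately show ?thesis using C that by blast
qed

lemma upper_level_set_cases:
  fixes g :: "real \<Rightarrow> real"
  assumes cont: "continuous_on UNIV g" and "mono g"
  shows "{y. g y > t} = {} \<or> {y. g y > t} = UNIV \<or> (\<exists>s. {y. g y > t} = {s<..})"
proof -
  let ?U = "{y. g y > t}"
  have "open ?U" by (rule open_Collect_less) (use cont in auto)
  have up: "y' \<in> ?U" if "y \<in> ?U" "y \<le> y'" for y y'
    using that monoD[OF \<open>mono g\<close>, of y y'] by auto
  have "\<exists>s. ?U = {s<..}" if ne: "?U \<noteq> {}" and "?U \<noteq> UNIV"
  proof -
    obtain z where z: "z \<notin> ?U" using \<open>?U \<noteq> UNIV\<close> by blast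
    have bdd: "bdd_below ?U" by (rule bdd_belowI[of _ z]) (use z up[of _ z] linear in blast)
    have low: "Inf ?U \<le> y" if "y \<in> ?U" for y by (rule cInf_lower[OF that bdd])
    have "Inf ?U \<notin> ?U"
    proof
      assume "Inf ?U \<in> ?U"
      with \<open>open ?U\<close> obtain e where e: "e > 0" "ball (Inf ?U) e \<subseteq> ?U"
        by (rule openE)
      have "Inf ?U - e / 2 \<in> ball (Inf ?U) e" using e(1) by (simp add: dist_real_def)
      then show False using low[OF subsetD[OF e(2)]] e(1) by fastforce
    qed
    moreover have "y \<in> ?U" if "y > Inf ?U" for y
      using that up cInf_lessD[OF ne, of y] by (meson less_imp_le)
    ultimately have "?U = {Inf ?U<..}"
      using low unfolding set_eq_iff greaterThan_iff by (metis order_le_less)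
    then show ?thesis by blast
  qed
  then show ?thesis by blast
qed

text \<open>Each event \<open>g (Y i) > y i\<close> is impossible, certain or again of the form \<open>Y i > s\<close>.  An impossible
one makes the left-hand side vanish; the certain ones are dropped from the index set.\<close>

lemma (in prob_space) upper_orthant_dominated_mono_comp:
  fixes g :: "real \<Rightarrow> real"
  assumes dom: "upper_orthant_dominated M C I Y" and "finite I" and "C \<ge> 0"
    and g: "continuous_on UNIV g" "mono g"
  shows "upper_orthant_dominated M C I (\<lambda>i \<omega>. g (Y i \<omega>))"
  unfolding upper_orthant_dominated_def
proof (intro conjI ballI allI impI)
  fix i assume i: "i \<in> I"
  have [measurable]: "g \<in> borel_measurable borel"
    using g(1) by (rule borel_measurable_continuous_onI)
  have [measurable]: "Y i \<in> borel_measurable M"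
    using dom i by (auto simp: upper_orthant_dominated_def)
  show "(\<lambda>\<omega>. g (Y i \<omega>)) \<in> borel_measurable M" by measurable
next
  fix J y assume J: "J \<subseteq> I"
  have "finite J" using J \<open>finite I\<close> by (rule finite_subset)
  show "prob {\<omega> \<in> space M. \<forall>i\<in>J. g (Y i \<omega>) > y i} \<le>
    C * (\<Prod>i\<in>J. prob {\<omega> \<in> space M. g (Y i \<omega>) > y i})"
  proof (cases "\<exists>i\<in>J. {z. g z > y i} = {}")
    case True
    then have "{\<omega> \<in> space M. \<forall>i\<in>J. g (Y i \<omega>) > y i} = {}" by blast
    then have "prob {\<omega> \<in> space M. \<forall>i\<in>J. g (Y i \<omega>) > y i} = 0" by (simp only: measure_empty)
    also have "\<dots> \<le> C * (\<Prod>i\<in>J. prob {\<omega> \<in> space M. g (Y i \<omega>) > y i})"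
      using \<open>C \<ge> 0\<close> by (intro mult_nonneg_nonneg prod_nonneg) auto
    finally show ?thesis .
  next
    case False
    define J' where "J' = {i\<in>J. {z. g z > y i} \<noteq> UNIV}"
    have "\<forall>i\<in>J'. \<exists>s. {z. g z > y i} = {s<..}"
      using False upper_level_set_cases[OF g] by (auto simp: J'_def)
    then obtain s where s: "\<And>i. i \<in> J' \<Longrightarrow> {z. g z > y i} = {s i<..}" by metis
    then have s': "g z > y i \<longleftrightarrow> z > s i" if "i \<in> J'" for i z
      using that by (metis greaterThan_iff mem_Collect_eq)
    have full: "g z > y i" if "i \<in> J" "i \<notin> J'" for i z
      using that by (auto simp: J'_def)
    have "(\<forall>i\<in>J. g (Y i \<omega>) > y i) \<longleftrightarrow> (\<forall>i\<in>J'. Y i \<omega> > s i)" for \<omega>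
    proof -
      have "(\<forall>i\<in>J. g (Y i \<omega>) > y i) \<longleftrightarrow> (\<forall>i\<in>J'. g (Y i \<omega>) > y i)"
        using full unfolding J'_def by blast
      also have "\<dots> \<longleftrightarrow> (\<forall>i\<in>J'. Y i \<omega> > s i)"
        by (rule ball_cong) (simp_all add: s')
      finally show ?thesis .
    qed
    then have "{\<omega> \<in> space M. \<forall>i\<in>J. g (Y i \<omega>) > y i} = {\<omega> \<in> space M. \<forall>i\<in>J'. Y i \<omega> > s i}"
      by blast
    also have "prob \<dots> \<le> C * (\<Prod>i\<in>J'. prob {\<omega> \<in> space M. Y i \<omega> > s i})"
    proof -
      have "J' \<subseteq> I" using J by (auto simp: J'_def)
      then show ?thesis using dom unfolding upper_orthant_dominated_def by blast
    qed
    also have "(\<Prod>i\<in>J'. prob {\<omega> \<in> space M. Y i \<omega> > s i})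
      = (\<Prod>i\<in>J'. prob {\<omega> \<in> space M. g (Y i \<omega>) > y i})"
      by (rule prod.cong) (auto simp: s')
    also have "\<dots> = (\<Prod>i\<in>J. prob {\<omega> \<in> space M. g (Y i \<omega>) > y i})"
    proof (rule prod.mono_neutral_left)
      show "\<forall>i\<in>J - J'. prob {\<omega> \<in> space M. g (Y i \<omega>) > y i} = 1"
        using full by (simp add: prob_space)
    qed (use \<open>finite J\<close> in \<open>auto simp: J'_def\<close>)
    finally show ?thesis .
  qed
qed

section \<open>Exponential moments under orthant domination\<close>

text \<open>The factor \<open>R\<close> will carry the variables and events of the other indices while the threshold of one
variable is integrated out.\<close>

lemma (in prob_space) nn_integral_layer_cake:
  fixes W :: "'a \<Rightarrow> real" and R :: "'a \<Rightarrow> ennreal"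
  assumes [measurable]: "W \<in> borel_measurable M" "R \<in> borel_measurable M"
    and "\<And>\<omega>. W \<omega> \<ge> 0"
  shows "(\<integral>\<^sup>+\<omega>. ennreal (W \<omega>) * R \<omega> \<partial>M)
    = (\<integral>\<^sup>+t. indicator {0..} t * (\<integral>\<^sup>+\<omega>. indicator {\<omega>\<in>space M. W \<omega> > t} \<omega> * R \<omega> \<partial>M) \<partial>lborel)"
proof -
  interpret P: pair_sigma_finite M lborel ..
  have W: "ennreal (W \<omega>) = (\<integral>\<^sup>+t. indicator {0..<W \<omega>} t \<partial>lborel)" for \<omega>
    using assms(3)[of \<omega>] by simp
  have "(\<integral>\<^sup>+\<omega>. ennreal (W \<omega>) * R \<omega> \<partial>M)
    = (\<integral>\<^sup>+\<omega>. (\<integral>\<^sup>+t. indicator {0..<W \<omega>} t * R \<omega> \<partial>lborel) \<partial>M)"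
    by (simp add: W nn_integral_multc)
  also have "\<dots> = (\<integral>\<^sup>+\<omega>. (\<integral>\<^sup>+t. indicator {0..} t * (if t < W \<omega> then R \<omega> else 0) \<partial>lborel) \<partial>M)"
    by (intro nn_integral_cong) (auto simp: indicator_def)
  also have "\<dots> = (\<integral>\<^sup>+t. (\<integral>\<^sup>+\<omega>. indicator {0..} t * (if t < W \<omega> then R \<omega> else 0) \<partial>M) \<partial>lborel)"
    by (rule P.Fubini'[symmetric]) measurable
  also have "\<dots> = (\<integral>\<^sup>+t. indicator {0..} t * (\<integral>\<^sup>+\<omega>. indicator {\<omega>\<in>space M. W \<omega> > t} \<omega> * R \<omega> \<partial>M) \<partial>lborel)"
    by (intro nn_integral_cong, subst nn_integral_cmult[symmetric])
       (auto intro!: nn_integral_cong simp: indicator_def)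
  finally show ?thesis .
qed

text \<open>For independent variables this would be the product formula for expectations.  The indicators of
the events \<open>W j > t j\<close> are replaced by the functions \<open>W j\<close> themselves one at a time: integrating the
inequality over the threshold \<open>t j\<close> performs one such step by the layer cake formula.  The induction
therefore runs over the set \<open>K\<close> of indices already replaced, while the indicators of the indices
in \<open>J\<close> are still present.\<close>

lemma (in prob_space) upper_orthant_dominated_nn_integral_prod:
  fixes W :: "'i \<Rightarrow> 'a \<Rightarrow> real"
  assumes dom: "upper_orthant_dominated M C I W" and "finite I" and "C \<ge> 0"
    and W: "\<And>i \<omega>. W i \<omega> \<ge> 0"
  shows "(\<integral>\<^sup>+\<omega>. (\<Prod>i\<in>I. ennreal (W i \<omega>)) \<partial>M)
    \<le> ennreal C * (\<Prod>i\<in>I. \<integral>\<^sup>+\<omega>. ennreal (W i \<omega>) \<partial>M)"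
proof -
  have meas[measurable]: "W i \<in> borel_measurable M" if "i \<in> I" for i
    using dom that by (auto simp: upper_orthant_dominated_def)
  let ?E = "\<lambda>i. \<integral>\<^sup>+\<omega>. ennreal (W i \<omega>) \<partial>M"
  let ?S = "\<lambda>J t. {\<omega> \<in> space M. \<forall>j\<in>J. W j \<omega> > t j}"
  have "(\<integral>\<^sup>+\<omega>. (\<Prod>i\<in>K. ennreal (W i \<omega>)) * indicator (?S J t) \<omega> \<partial>M)
    \<le> ennreal C * (\<Prod>i\<in>K. ?E i) * (\<Prod>j\<in>J. ennreal (prob {\<omega> \<in> space M. W j \<omega> > t j}))"
    if "finite K" "K \<subseteq> I" "J \<subseteq> I - K" for K J and t :: "'i \<Rightarrow> real"
    using that
  proof (induction K arbitrary: J t rule: finite_induct)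
    case empty
    have "finite J" using empty \<open>finite I\<close> finite_subset by auto
    have [measurable]: "?S J t \<in> events"
      using \<open>finite J\<close> empty by (intro sets.sets_Collect_finite_All) (auto intro!: borel_measurable_less meas)
    have "emeasure M (?S J t) = ennreal (prob (?S J t))" by (rule emeasure_eq_measure)
    also have "\<dots> \<le> ennreal (C * (\<Prod>j\<in>J. prob {\<omega> \<in> space M. W j \<omega> > t j}))"
      using dom empty by (auto simp: upper_orthant_dominated_def intro!: ennreal_leI)
    also have "\<dots> = ennreal C * (\<Prod>j\<in>J. ennreal (prob {\<omega> \<in> space M. W j \<omega> > t j}))"
      using \<open>C \<ge> 0\<close> by (simp add: ennreal_mult prod_ennreal prod_nonneg)
    finally show ?case by simp
  next
    case (insert k K)
    have k: "k \<in> I" and kJ: "k \<notin> J" and JI: "J \<subseteq> I" and KI: "K \<subseteq> I" using insert.prems by auto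
    have "finite J" using JI \<open>finite I\<close> finite_subset by auto
    have [measurable]: "?S J t \<in> events"
      using \<open>finite J\<close> JI by (intro sets.sets_Collect_finite_All) (auto intro!: borel_measurable_less meas)
    have [measurable]: "W k \<in> borel_measurable M" using meas k .
    have [measurable]: "(\<lambda>\<omega>. \<Prod>i\<in>K. ennreal (W i \<omega>)) \<in> borel_measurable M"
      using KI meas by (intro borel_measurable_prod_ennreal measurable_compose[OF _ measurable_ennreal]) auto
    let ?R = "\<lambda>\<omega>. (\<Prod>i\<in>K. ennreal (W i \<omega>)) * indicator (?S J t) \<omega>"
    let ?c = "ennreal C * (\<Prod>i\<in>K. ?E i) * (\<Prod>j\<in>J. ennreal (prob {\<omega> \<in> space M. W j \<omega> > t j}))"
    have slice: "(\<integral>\<^sup>+\<omega>. indicator {\<omega>\<in>space M. W k \<omega> > s} \<omega> * ?R \<omega> \<partial>M)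
        \<le> ?c * ennreal (prob {\<omega> \<in> space M. W k \<omega> > s})" for s
    proof -
      let ?t = "t(k := s)"
      have "(\<integral>\<^sup>+\<omega>. indicator {\<omega>\<in>space M. W k \<omega> > s} \<omega> * ?R \<omega> \<partial>M)
        = (\<integral>\<^sup>+\<omega>. (\<Prod>i\<in>K. ennreal (W i \<omega>)) * indicator (?S (insert k J) ?t) \<omega> \<partial>M)"
        using kJ by (intro nn_integral_cong) (auto simp: indicator_def)
      also have "\<dots> \<le> ennreal C * (\<Prod>i\<in>K. ?E i)
          * (\<Prod>j\<in>insert k J. ennreal (prob {\<omega> \<in> space M. W j \<omega> > ?t j}))"
        using insert.prems insert.hyps by (intro insert.IH) auto
      also have "(\<Prod>j\<in>insert k J. ennreal (prob {\<omega> \<in> space M. W j \<omega> > ?t j}))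
        = ennreal (prob {\<omega> \<in> space M. W k \<omega> > s}) * (\<Prod>j\<in>J. ennreal (prob {\<omega> \<in> space M. W j \<omega> > t j}))"
        using kJ \<open>finite J\<close> by (auto intro!: arg_cong2[of _ _ _ _ "(*)"] prod.cong)
      finally show ?thesis by (simp add: mult_ac)
    qed
    have "(\<integral>\<^sup>+\<omega>. (\<Prod>i\<in>insert k K. ennreal (W i \<omega>)) * indicator (?S J t) \<omega> \<partial>M)
      = (\<integral>\<^sup>+\<omega>. ennreal (W k \<omega>) * ?R \<omega> \<partial>M)"
      using insert.hyps by (simp add: mult.assoc)
    also have "\<dots> = (\<integral>\<^sup>+s. indicator {0..} s
        * (\<integral>\<^sup>+\<omega>. indicator {\<omega>\<in>space M. W k \<omega> > s} \<omega> * ?R \<omega> \<partial>M) \<partial>lborel)"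
      by (rule nn_integral_layer_cake) (use W in auto)
    also have "\<dots> \<le> (\<integral>\<^sup>+s. ?c * (indicator {0..} s * emeasure M {\<omega> \<in> space M. W k \<omega> > s}) \<partial>lborel)"
    proof (rule nn_integral_mono)
      fix s :: real
      have "indicator {0..} s * (\<integral>\<^sup>+\<omega>. indicator {\<omega>\<in>space M. W k \<omega> > s} \<omega> * ?R \<omega> \<partial>M)
          \<le> indicator {0..} s * (?c * ennreal (prob {\<omega> \<in> space M. W k \<omega> > s}))"
        by (rule mult_left_mono[OF slice]) simp
      then show "indicator {0..} s * (\<integral>\<^sup>+\<omega>. indicator {\<omega>\<in>space M. W k \<omega> > s} \<omega> * ?R \<omega> \<partial>M)
          \<le> ?c * (indicator {0..} s * emeasure M {\<omega> \<in> space M. W k \<omega> > s})"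
        by (simp add: mult_ac emeasure_eq_measure)
    qed
    also have "\<dots> = ?c * (\<integral>\<^sup>+s. indicator {0..} s * emeasure M {\<omega> \<in> space M. W k \<omega> > s} \<partial>lborel)"
      by (rule nn_integral_cmult) measurable
    also have "(\<integral>\<^sup>+s. indicator {0..} s * emeasure M {\<omega> \<in> space M. W k \<omega> > s} \<partial>lborel) = ?E k"
      using nn_integral_layer_cake[of "W k" "\<lambda>_. 1"] W by simp
    finally show ?case using insert.hyps by (simp add: mult_ac)
  qed
  from this[of I "{}"] show ?thesis using \<open>finite I\<close> by simp
qed

text \<open>Markov's inequality for the exponential of the sum; the constant \<open>C\<close> is the only price paid for
dependence.\<close>

lemma (in prob_space) chernoff_sum_le:
  fixes Z :: "'i \<Rightarrow> 'a \<Rightarrow> real"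
  assumes dom: "upper_orthant_dominated M C I (\<lambda>i \<omega>. exp (h * Z i \<omega>))"
    and "finite I" "C \<ge> 0" "h > 0" "B \<ge> 0"
    and Z: "\<And>i. i \<in> I \<Longrightarrow> Z i \<in> borel_measurable M"
    and B: "\<And>i. i \<in> I \<Longrightarrow> (\<integral>\<^sup>+\<omega>. ennreal (exp (h * Z i \<omega>)) \<partial>M) \<le> ennreal B"
  shows "prob {\<omega> \<in> space M. (\<Sum>i\<in>I. Z i \<omega>) > s} \<le> exp (- h * s) * C * B ^ card I"
proof -
  have [measurable]: "(\<lambda>\<omega>. \<Sum>i\<in>I. Z i \<omega>) \<in> borel_measurable M"
    using Z by simp
  let ?A = "{\<omega> \<in> space M. (\<Sum>i\<in>I. Z i \<omega>) > s}"
  have "ennreal (prob ?A) = (\<integral>\<^sup>+\<omega>. indicator ?A \<omega> \<partial>M)"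
    by (simp add: emeasure_eq_measure)
  also have "\<dots> \<le> (\<integral>\<^sup>+\<omega>. ennreal (exp (- h * s)) * (\<Prod>i\<in>I. ennreal (exp (h * Z i \<omega>))) \<partial>M)"
  proof (rule nn_integral_mono)
    fix \<omega>
    have "ennreal (exp (- h * s)) * (\<Prod>i\<in>I. ennreal (exp (h * Z i \<omega>)))
        = ennreal (exp (h * ((\<Sum>i\<in>I. Z i \<omega>) - s)))"
      using \<open>finite I\<close>
      by (simp add: prod_ennreal prod_nonneg ennreal_mult[symmetric] exp_sum[symmetric]
          exp_add[symmetric] sum_distrib_left algebra_simps)
    moreover have "1 \<le> exp (h * ((\<Sum>i\<in>I. Z i \<omega>) - s))" if "\<omega> \<in> ?A"
      using that \<open>h > 0\<close> by simp
    ultimately show "indicator ?A \<omega> \<le> ennreal (exp (- h * s)) * (\<Prod>i\<in>I. ennreal (exp (h * Z i \<omega>)))"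
      by (auto simp: indicator_def)
  qed
  also have "\<dots> = ennreal (exp (- h * s)) * (\<integral>\<^sup>+\<omega>. (\<Prod>i\<in>I. ennreal (exp (h * Z i \<omega>))) \<partial>M)"
    by (rule nn_integral_cmult, rule borel_measurable_prod_ennreal) (use Z in measurable)
  also have "\<dots> \<le> ennreal (exp (- h * s)) * (ennreal C * (\<Prod>i\<in>I. \<integral>\<^sup>+\<omega>. ennreal (exp (h * Z i \<omega>)) \<partial>M))"
    by (intro mult_left_mono upper_orthant_dominated_nn_integral_prod[OF dom]) (use assms in auto)
  also have "\<dots> \<le> ennreal (exp (- h * s)) * (ennreal C * (\<Prod>i\<in>I. ennreal B))"
    by (intro mult_left_mono prod_mono_ennreal B) auto
  also have "\<dots> = ennreal (exp (- h * s) * C * B ^ card I)"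
    using assms by (simp add: ennreal_power ennreal_mult mult.assoc)
  finally show ?thesis
    using assms by (subst (asm) ennreal_le_iff) auto
qed

section \<open>Truncated moments of an integrable distribution\<close>

definition clip :: "real \<Rightarrow> real \<Rightarrow> real \<Rightarrow> real" where
  "clip c b y = max (- c) (min b y)"

lemma borel_measurable_clip [measurable]: "clip b d \<in> borel_measurable borel"
  unfolding clip_def[abs_def] by measurable

lemma exp_le_add_min:
  fixes u :: real
  assumes "u \<le> 1"
  shows "exp u \<le> 1 + u + \<bar>u\<bar> * min 1 \<bar>u\<bar>"
proof -
  consider "0 \<le> u" | "- 1 < u" "u < 0" | "u \<le> - 1" by linarith
  then show ?thesis
  proof cases
    case 1
    then show ?thesis using exp_bound[of u] assms by (simp add: power2_eq_square)
  next
    case 2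
    have "1 - u \<le> exp (- u)" using exp_ge_add_one_self[of "- u"] by simp
    then have "exp u * (1 - u) \<le> exp u * exp (- u)" by (rule mult_left_mono) simp
    also have "\<dots> = 1" by (simp add: exp_minus)
    also have "1 \<le> 1 - u * u * u" using 2 by (simp add: mult_le_0_iff)
    also have "\<dots> = (1 + u + u * u) * (1 - u)" by (simp add: algebra_simps)
    finally have "exp u \<le> 1 + u + u * u"
      using 2 by (simp add: mult_le_cancel_right)
    then show ?thesis using 2 by (simp add: min_def)
  next
    case 3
    then show ?thesis by simp
  qed
qed

text \<open>With \<open>z = clip c b y\<close>, the function \<open>exp (h * z) - 1 - h * z\<close> is at most
\<open>h * \<bar>y\<bar> * min 1 (h * \<bar>y\<bar>)\<close> as long as \<open>h * z \<le> 1\<close>, and at most \<open>exp (h * b)\<close> otherwise, which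
happens only for \<open>y > 1 / h\<close>.  The first bound has an integral of order \<open>o(h)\<close> by dominated
convergence, from the first moment alone.  The term with \<open>\<bar>y\<bar> - c\<close> is the price
of clipping from below.\<close>

lemma clip_mgf_le:
  assumes "real_distribution H" and int: "integrable H (\<lambda>y. y)"
    and "h > 0" "b \<ge> 0" "c \<ge> 0"
  shows "(\<integral>\<^sup>+y. ennreal (exp (h * clip c b y)) \<partial>H)
    \<le> ennreal (1 + h * ((\<integral>y. y \<partial>H) + (\<integral>y. max 0 (\<bar>y\<bar> - c) \<partial>H) + (\<integral>y. \<bar>y\<bar> * min 1 (h * \<bar>y\<bar>) \<partial>H))
        + exp (h * b) * measure H {1 / h<..})"
proof -
  interpret real_distribution H by fact
  have int_abs: "integrable H (\<lambda>y. \<bar>y\<bar>)" using int by simp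
  have int1: "integrable H (\<lambda>y. max 0 (\<bar>y\<bar> - c))"
    by (rule Bochner_Integration.integrable_bound[OF int_abs]) (use \<open>c \<ge> 0\<close> in auto)
  have int2: "integrable H (\<lambda>y. \<bar>y\<bar> * min 1 (h * \<bar>y\<bar>))"
    by (rule Bochner_Integration.integrable_bound[OF int_abs])
       (use \<open>h > 0\<close> in \<open>auto intro!: mult_left_le simp: abs_mult\<close>)
  let ?g = "\<lambda>y. 1 + h * (y + max 0 (\<bar>y\<bar> - c) + \<bar>y\<bar> * min 1 (h * \<bar>y\<bar>))
      + exp (h * b) * indicator {1 / h<..} y"
  have bound: "exp (h * clip c b y) \<le> ?g y" for y
  proof -
    have clip_le: "clip c b y \<le> y + max 0 (\<bar>y\<bar> - c)" and abs_clip: "\<bar>clip c b y\<bar> \<le> \<bar>y\<bar>"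
      and clip_b: "clip c b y \<le> b"
      using assms by (auto simp: clip_def)
    have "\<bar>h * clip c b y\<bar> * min 1 \<bar>h * clip c b y\<bar> \<le> (h * \<bar>y\<bar>) * min 1 (h * \<bar>y\<bar>)"
      using abs_clip \<open>h > 0\<close> by (intro mult_mono min.mono) (auto simp: abs_mult)
    moreover have "h * clip c b y \<le> h * (y + max 0 (\<bar>y\<bar> - c))"
      using clip_le \<open>h > 0\<close> by simp
    ultimately have small: "exp (h * clip c b y) \<le> 1 + h * (y + max 0 (\<bar>y\<bar> - c) + \<bar>y\<bar> * min 1 (h * \<bar>y\<bar>))"
      if "h * clip c b y \<le> 1"
      using exp_le_add_min[OF that] by (simp add: algebra_simps)
    have g0: "0 \<le> 1 + h * (y + max 0 (\<bar>y\<bar> - c) + \<bar>y\<bar> * min 1 (h * \<bar>y\<bar>))" if "y > 0"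
      using that \<open>h > 0\<close> by (intro add_nonneg_nonneg mult_nonneg_nonneg) auto
    show ?thesis
    proof (cases "y > 1 / h")
      case True
      then have "y > 0" using \<open>h > 0\<close> by (meson divide_pos_pos less_trans zero_less_one)
      have "exp (h * clip c b y) \<le> exp (h * b)" using clip_b \<open>h > 0\<close> by simp
      then show ?thesis using g0[OF \<open>y > 0\<close>] True by (simp del: exp_le_cancel_iff)
    next
      case False
      moreover have "0 < 1 / h" using \<open>h > 0\<close> by simp
      ultimately have "clip c b y \<le> 1 / h" using \<open>c \<ge> 0\<close> unfolding clip_def by linarith
      then have "h * clip c b y \<le> 1" using \<open>h > 0\<close> by (simp add: field_simps)
      with small False show ?thesis by simp
    qed
  qed
  have "has_bochner_integral H (\<lambda>y. 1 :: real) 1"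
    using prob_space by (simp add: has_bochner_integral_iff)
  moreover have "has_bochner_integral H (\<lambda>y. indicator {1 / h<..} y :: real) (measure H {1 / h<..})"
    by (rule has_bochner_integral_real_indicator) (auto simp: emeasure_eq_measure)
  ultimately have g: "has_bochner_integral H ?g
      (1 + h * ((\<integral>y. y \<partial>H) + (\<integral>y. max 0 (\<bar>y\<bar> - c) \<partial>H) + (\<integral>y. \<bar>y\<bar> * min 1 (h * \<bar>y\<bar>) \<partial>H))
        + exp (h * b) * measure H {1 / h<..})"
    by (intro has_bochner_integral_add has_bochner_integral_mult_right
        has_bochner_integral_integrable[OF int] has_bochner_integral_integrable[OF int1]
        has_bochner_integral_integrable[OF int2])
  have "(\<integral>\<^sup>+y. ennreal (exp (h * clip c b y)) \<partial>H) \<le> (\<integral>\<^sup>+y. ennreal (?g y) \<partial>H)"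
    by (intro nn_integral_mono ennreal_leI bound)
  also have "\<dots> = ennreal (\<integral>y. ?g y \<partial>H)"
    using bound by (intro nn_integral_eq_integral AE_I2 integrable.intros[OF g]) (meson exp_ge_zero order_trans)
  also note has_bochner_integral_integral_eq[OF g]
  finally show ?thesis .
qed

lemma integrable_excess_tendsto_0:
  assumes "real_distribution H" and int: "integrable H (\<lambda>y. y)"
  shows "((\<lambda>c. \<integral>y. max 0 (\<bar>y\<bar> - c) \<partial>H) \<longlongrightarrow> 0) at_top"
proof -
  interpret real_distribution H by fact
  have "((\<lambda>c. \<integral>y. max 0 (\<bar>y\<bar> - c) \<partial>H) \<longlongrightarrow> (\<integral>y. 0 \<partial>H)) at_top"
  proof (rule integral_dominated_convergence_at_top[where w = "\<lambda>y. \<bar>y\<bar>"])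
    show "AE y in H. ((\<lambda>c. max 0 (\<bar>y\<bar> - c)) \<longlongrightarrow> 0) at_top"
    proof (rule AE_I2)
      fix y :: real
      show "((\<lambda>c. max 0 (\<bar>y\<bar> - c)) \<longlongrightarrow> 0) at_top"
        by (rule tendsto_eventually) (use eventually_ge_at_top[of "\<bar>y\<bar>"] in eventually_elim, simp)
    qed
    show "\<forall>\<^sub>F c in at_top. AE y in H. norm (max 0 (\<bar>y\<bar> - c)) \<le> \<bar>y\<bar>"
      using eventually_ge_at_top[of 0] by eventually_elim auto
    show "(\<lambda>y. max 0 (\<bar>y\<bar> - c)) \<in> borel_measurable H" for c by measurable
    show "integrable H (\<lambda>y. \<bar>y\<bar>)" using int by simp
  qed simp
  then show ?thesis by simp
qed

lemma integrable_quadratic_min_tendsto_0: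
  assumes "real_distribution H" and int: "integrable H (\<lambda>y. y)"
  shows "((\<lambda>s. \<integral>y. \<bar>y\<bar> * min 1 (1 / s * \<bar>y\<bar>) \<partial>H) \<longlongrightarrow> 0) at_top"
proof -
  interpret real_distribution H by fact
  have "((\<lambda>s. \<integral>y. \<bar>y\<bar> * min 1 (1 / s * \<bar>y\<bar>) \<partial>H) \<longlongrightarrow> (\<integral>y. 0 \<partial>H)) at_top"
  proof (rule integral_dominated_convergence_at_top[where w = "\<lambda>y. \<bar>y\<bar>"])
    show "AE y in H. ((\<lambda>s. \<bar>y\<bar> * min 1 (1 / s * \<bar>y\<bar>)) \<longlongrightarrow> 0) at_top"
    proof (rule AE_I2)
      fix y :: real
      have "((\<lambda>s. 1 / s * \<bar>y\<bar>) \<longlongrightarrow> 0) at_top" by real_asymp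
      then have "((\<lambda>s. \<bar>y\<bar> * min 1 (1 / s * \<bar>y\<bar>)) \<longlongrightarrow> \<bar>y\<bar> * min 1 0) at_top"
        by (intro tendsto_intros)
      then show "((\<lambda>s. \<bar>y\<bar> * min 1 (1 / s * \<bar>y\<bar>)) \<longlongrightarrow> 0) at_top" by simp
    qed
    show "\<forall>\<^sub>F s in at_top. AE y in H. norm (\<bar>y\<bar> * min 1 (1 / s * \<bar>y\<bar>)) \<le> \<bar>y\<bar>"
      using eventually_gt_at_top[of 0]
    proof eventually_elim
      case (elim s)
      have "norm (\<bar>y\<bar> * min 1 (1 / s * \<bar>y\<bar>)) \<le> \<bar>y\<bar>" for y
      proof -
        have "0 \<le> 1 / s * \<bar>y\<bar>" using elim by simp
        then have "\<bar>min 1 (1 / s * \<bar>y\<bar>)\<bar> \<le> 1" by linarith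
        then show ?thesis unfolding real_norm_def abs_mult abs_abs by (rule mult_left_le) simp
      qed
      then show ?case by simp
    qed
    show "(\<lambda>y. \<bar>y\<bar> * min 1 (1 / c * \<bar>y\<bar>)) \<in> borel_measurable H" for c by measurable
    show "integrable H (\<lambda>y. \<bar>y\<bar>)" using int by simp
  qed simp
  then show ?thesis by simp
qed

lemma integrable_mult_tail_tendsto_0:
  assumes "real_distribution H" and int: "integrable H (\<lambda>y. y)"
  shows "((\<lambda>x. x * measure H {x<..}) \<longlongrightarrow> 0) at_top"
proof -
  interpret real_distribution H by fact
  have "((\<lambda>x. \<integral>y. x * indicator {x<..} y \<partial>H) \<longlongrightarrow> (\<integral>y. 0 \<partial>H)) at_top"
  proof (rule integral_dominated_convergence_at_top[where w = "\<lambda>y. \<bar>y\<bar>"])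
    show "AE y in H. ((\<lambda>x. x * indicator {x<..} y) \<longlongrightarrow> (0::real)) at_top"
    proof (rule AE_I2)
      fix y :: real
      show "((\<lambda>x. x * indicator {x<..} y) \<longlongrightarrow> (0::real)) at_top"
        by (rule tendsto_eventually) (use eventually_ge_at_top[of y] in eventually_elim, simp)
    qed
    show "\<forall>\<^sub>F x in at_top. AE y in H. norm (x * indicator {x<..} y :: real) \<le> \<bar>y\<bar>"
      using eventually_ge_at_top[of 0] by eventually_elim (auto simp: indicator_def)
    show "(\<lambda>y. c * indicator {c<..} y :: real) \<in> borel_measurable H" for c by measurable
    show "integrable H (\<lambda>y. \<bar>y\<bar>)" using int by simp
  qed simp
  then show ?thesis by simp
qed

section \<open>Functions with the doubling property\<close>

text \<open>Iterating the doubling inequality about \<open>log 2 s\<close> times gives a factor \<open>s ^ p\<close>; the extra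
\<open>2 ^ p\<close> accounts for rounding the number of iterations.\<close>

lemma doubling_imp_polynomial:
  fixes G :: "real \<Rightarrow> real"
  assumes anti: "antimono G" and pos: "\<And>t. G t > 0" and "t0 > 0"
    and doubling: "\<And>t. t \<ge> t0 \<Longrightarrow> G (t / 2) \<le> 2 ^ p * G t"
    and "s \<ge> 1" "t \<ge> s * t0"
  shows "G (t / s) \<le> 2 ^ p * s ^ p * G t"
proof -
  obtain k where "s < 2 ^ k" using real_arch_pow[of 2 s] by auto
  then have "s < 2 ^ Suc k" using \<open>s \<ge> 1\<close> by simp
  then show ?thesis using \<open>s \<ge> 1\<close> \<open>t \<ge> s * t0\<close>
  proof (induction k arbitrary: s t)
    case 0
    have t: "t \<ge> t0" "t > 0"
      using 0 \<open>t0 > 0\<close> by (smt (verit) mult_le_cancel_right1)+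
    have "t / 2 \<le> t / s" using 0 t by (intro divide_left_mono) auto
    then have "G (t / s) \<le> G (t / 2)" by (rule antimonoD[OF anti])
    also have "\<dots> \<le> 2 ^ p * G t" using doubling t by simp
    also have "\<dots> \<le> 2 ^ p * s ^ p * G t"
      using 0 pos[of t] by simp
    finally show ?case .
  next
    case (Suc k)
    show ?case
    proof (cases "s < 2")
      case True
      moreover have "(2::real) \<le> 2 ^ Suc k" by simp
      ultimately show ?thesis using Suc.prems by (intro Suc.IH) linarith+
    next
      case False
      have t: "t \<ge> t0"
        using Suc.prems \<open>t0 > 0\<close> by (smt (verit) mult_le_cancel_right1)
      have "G (t / s) = G ((t / 2) / (s / 2))" by simp
      also have "\<dots> \<le> 2 ^ p * (s / 2) ^ p * G (t / 2)"
        using False Suc.prems by (intro Suc.IH) auto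
      also have "\<dots> \<le> 2 ^ p * (s / 2) ^ p * (2 ^ p * G t)"
        using doubling[OF t] False by (intro mult_left_mono) auto
      also have "\<dots> = 2 ^ p * s ^ p * G t"
        by (simp add: power_divide)
      finally show ?thesis .
    qed
  qed
qed

text \<open>A tail with the doubling property decays at most polynomially, hence its logarithm grows at most
like \<open>ln t\<close>.\<close>

lemma doubling_imp_log_negligible:
  fixes G :: "real \<Rightarrow> real"
  assumes anti: "antimono G" and pos: "\<And>t. G t > 0" and "t0 > 0"
    and doubling: "\<And>t. t \<ge> t0 \<Longrightarrow> G (t / 2) \<le> 2 ^ p * G t"
    and "K \<ge> 0"
  shows "\<forall>\<^sub>F t in at_top. K * - ln (G t) \<le> t"
proof -
  define c where "c = p * ln 2 - p * ln t0 - ln (G t0)"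
  have "((\<lambda>t::real. K * (c + real p * ln t) / t) \<longlongrightarrow> 0) at_top" by real_asymp
  then have "\<forall>\<^sub>F t in at_top. K * (c + real p * ln t) / t < 1"
    by (rule order_tendstoD) simp
  then show ?thesis using eventually_ge_at_top[of t0]
  proof eventually_elim
    case (elim t)
    have t: "t > 0" using elim \<open>t0 > 0\<close> by linarith
    have "G (t / (t / t0)) \<le> 2 ^ p * (t / t0) ^ p * G t"
      by (rule doubling_imp_polynomial[OF anti pos \<open>t0 > 0\<close> doubling]) (use elim \<open>t0 > 0\<close> in auto)
    then have "G t0 \<le> 2 ^ p * (t / t0) ^ p * G t" using t by simp
    then have "ln (G t0) \<le> ln (2 ^ p * (t / t0) ^ p * G t)"
      using pos t \<open>t0 > 0\<close> by (subst ln_le_cancel_iff) auto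
    also have "\<dots> = p * ln 2 + p * (ln t - ln t0) + ln (G t)"
      using pos[of t] t \<open>t0 > 0\<close> by (simp add: ln_mult ln_div ln_realpow)
    finally have "- ln (G t) \<le> c + real p * ln t" by (simp add: c_def algebra_simps)
    then have "K * - ln (G t) \<le> K * (c + real p * ln t)"
      using \<open>K \<ge> 0\<close> by (rule mult_left_mono)
    also have "\<dots> \<le> t" using elim t by (simp add: field_simps)
    finally show ?case .
  qed
qed

section \<open>Large deviations of truncated sums\<close>

lemma filterlim_mult_at_top: "v > 0 \<Longrightarrow> filterlim (\<lambda>x. v * x) at_top (at_top :: real filter)"
  by (intro filterlim_tendsto_pos_mult_at_top[OF tendsto_const _ filterlim_ident])

text \<open>The large deviation estimate behind the theorem.  Put \<open>q = n * G (v * x)\<close>, which is small uniformly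
in \<open>n \<le> x / \<gamma>\<close>, and \<open>a = - ln q\<close>; apply the Chernoff bound with parameter \<open>h = a / (2 * v * x)\<close>.

Then \<open>exp (h * v * x) = q powr (-1/2)\<close>, while \<open>G (1 / h)\<close> exceeds \<open>G (v * x)\<close> only by a factor of
order \<open>a ^ p\<close>.  Hence \<open>n\<close> times the last term of \<open>clip_mgf_le\<close> is of order \<open>a ^ p * exp (- a / 2)\<close> and
stays bounded.  The linear terms contribute \<open>n * h * o(1)\<close>, which is at most half of \<open>h * \<epsilon> * x\<close>
because \<open>n \<le> x / \<gamma>\<close>.  What remains is a constant times
\<open>exp (- h * \<epsilon> * x / 2) = q powr (\<epsilon> / (4 * v))\<close>, which is at most \<open>q\<^sup>2\<close> as soon as \<open>8 * v \<le> \<epsilon>\<close>.  Thus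
truncation at a small multiple of \<open>x\<close> makes the probability quadratic in \<open>q\<close>, hence \<open>o(q)\<close>, and
\<open>q\<close> is comparable to \<open>n * G x\<close>.\<close>

lemma (in prob_space) truncated_sum_negligible:
  fixes G :: "real \<Rightarrow> real" and Y :: "nat \<Rightarrow> 'a \<Rightarrow> real" and H :: "real measure"
  assumes H: "real_distribution H" "integrable H (\<lambda>y. y)" "(\<integral>y. y \<partial>H) = 0"
    and anti: "antimono G" and pos: "\<And>t. G t > 0" and "t0 > 0"
    and doubling: "\<And>t. t \<ge> t0 \<Longrightarrow> G (t / 2) \<le> 2 ^ p * G t"
    and G_lim: "((\<lambda>t. t * G t) \<longlongrightarrow> 0) at_top"
    and HG: "\<forall>\<^sub>F t in at_top. measure H {t<..} \<le> G t"
    and dom: "\<And>n. upper_orthant_dominated M C {1..n} Y" and "C > 0"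
    and distr: "\<And>i. i \<ge> 1 \<Longrightarrow> distr M borel (Y i) = H"
    and "\<gamma> > 0" "c > 0" "v > 0" "v \<le> 1" "8 * v \<le> \<epsilon>" "\<eta> > 0"
  shows "\<forall>\<^sub>F x in at_top. \<forall>n\<ge>1. \<gamma> * real n \<le> x \<longrightarrow>
    prob {\<omega> \<in> space M. (\<Sum>i=1..n. clip (c * x) (v * x) (Y i \<omega>)) > \<epsilon> * x} \<le> \<eta> * (real n * G x)"
proof -
  have "\<epsilon> > 0" using assms by linarith
  define K where "K = 2 ^ p * (1 / v) ^ p"
  have "K > 0" using \<open>v > 0\<close> by (simp add: K_def)
  have "((\<lambda>a::real. 2 ^ p * a ^ p * exp (- a / 2)) \<longlongrightarrow> 0) at_top" by real_asymp
  then have "\<forall>\<^sub>F a::real in at_top. 2 ^ p * a ^ p * exp (- a / 2) < 1"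
    by (rule order_tendstoD) simp
  then have "\<forall>\<^sub>F a::real in at_top. a \<ge> 2 \<and> 2 ^ p * a ^ p * exp (- a / 2) < 1"
    using eventually_ge_at_top[of 2] by eventually_elim auto
  then obtain A where A: "\<And>a::real. a \<ge> A \<Longrightarrow> a \<ge> 2 \<and> 2 ^ p * a ^ p * exp (- a / 2) < 1"
    by (auto simp: eventually_at_top_linorder)
  let ?\<kappa> = "\<lambda>s. \<integral>y. \<bar>y\<bar> * min 1 (1 / s * \<bar>y\<bar>) \<partial>H"
  let ?\<rho> = "\<lambda>x. \<integral>y. max 0 (\<bar>y\<bar> - x) \<partial>H"
  have "\<forall>\<^sub>F s in at_top. ?\<kappa> s < \<gamma> * \<epsilon> / 4"
    using integrable_quadratic_min_tendsto_0[OF H(1,2)] by (rule order_tendstoD) (use \<open>\<gamma> > 0\<close> \<open>\<epsilon> > 0\<close> in simp)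
  then have "\<forall>\<^sub>F s in at_top. s > 0 \<and> s \<ge> t0 \<and> ?\<kappa> s \<le> \<gamma> * \<epsilon> / 4 \<and> measure H {s<..} \<le> G s"
    using HG eventually_gt_at_top[of 0] eventually_ge_at_top[of t0] by eventually_elim auto
  then obtain s0 where s0: "\<And>s. s \<ge> s0 \<Longrightarrow> s > 0 \<and> s \<ge> t0 \<and> ?\<kappa> s \<le> \<gamma> * \<epsilon> / 4 \<and> measure H {s<..} \<le> G s"
    by (auto simp: eventually_at_top_linorder)
  have s0_pos: "s0 > 0" using s0[of s0] by simp
  define \<delta> where "\<delta> = min (exp (- A)) (\<eta> / (C * exp 1 * K))"
  have "\<delta> > 0" using \<open>\<eta> > 0\<close> \<open>C > 0\<close> \<open>K > 0\<close> by (simp add: \<delta>_def)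
  have vx: "filterlim (\<lambda>x. v * x) at_top at_top"
    using \<open>v > 0\<close> by (rule filterlim_mult_at_top)
  have "((\<lambda>x. (v * x) * G (v * x)) \<longlongrightarrow> 0) at_top"
    using G_lim vx by (rule filterlim_compose)
  then have e1: "\<forall>\<^sub>F x in at_top. (v * x) * G (v * x) < v * \<gamma> * \<delta>"
    by (rule order_tendstoD) (use \<open>v > 0\<close> \<open>\<gamma> > 0\<close> \<open>\<delta> > 0\<close> in simp)
  \<comment> \<open>This makes \<open>s \<ge> s0\<close> below for all admissible \<open>n\<close> at once, since \<open>a \<le> - ln (G (v * x))\<close>.\<close>
  have e2: "\<forall>\<^sub>F x in at_top. (s0 / 2) * - ln (G (v * x)) \<le> v * x"
    by (rule eventually_compose_filterlim[OF
          doubling_imp_log_negligible[OF anti pos \<open>t0 > 0\<close> doubling] vx]) (use s0_pos in auto)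
  have cx: "filterlim (\<lambda>x. c * x) at_top at_top"
    using \<open>c > 0\<close> by (rule filterlim_mult_at_top)
  have "((\<lambda>x. ?\<rho> (c * x)) \<longlongrightarrow> 0) at_top"
    using integrable_excess_tendsto_0[OF H(1,2)] cx by (rule filterlim_compose)
  then have e3: "\<forall>\<^sub>F x in at_top. ?\<rho> (c * x) < \<gamma> * \<epsilon> / 4"
    by (rule order_tendstoD) (use \<open>\<gamma> > 0\<close> \<open>\<epsilon> > 0\<close> in simp)
  show ?thesis
    using e1 e2 e3 eventually_gt_at_top[of 0] eventually_ge_at_top[of "t0 / v"]
  proof eventually_elim
    case (elim x)
    show ?case
    proof (intro allI impI)
      fix n :: nat
      assume "n \<ge> 1" and nx: "\<gamma> * real n \<le> x"
      have "x > 0" "real n > 0" using elim \<open>n \<ge> 1\<close> by auto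
      define q where "q = real n * G (v * x)"
      define a where "a = - ln q"
      \<comment> \<open>The Chernoff parameter is \<open>1 / s\<close>; beyond \<open>s\<close> the exponent \<open>y / s\<close> exceeds 1.\<close>
      define s where "s = 2 * (v * x) / a"
      have "q > 0" using \<open>n \<ge> 1\<close> pos by (simp add: q_def)
      have q_exp: "q = exp (- a)" using \<open>q > 0\<close> by (simp add: a_def)
      have "\<gamma> * q = (\<gamma> * n) * G (v * x)" by (simp add: q_def)
      also have "\<dots> \<le> x * G (v * x)" using nx pos[of "v * x"] by (simp add: mult_right_mono)
      also have "\<dots> \<le> \<gamma> * \<delta>"
        using elim(1) \<open>v > 0\<close> by (simp add: mult.assoc)
      finally have "q \<le> \<delta>" using \<open>\<gamma> > 0\<close> by simp
      then have "exp (- a) \<le> exp (- A)" using q_exp by (simp add: \<delta>_def)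
      then have a: "a \<ge> 2" "2 ^ p * a ^ p * exp (- a / 2) < 1" using A[of a] by auto
      have "a \<le> - ln (G (v * x))"
      proof -
        have "G (v * x) \<le> q" using \<open>n \<ge> 1\<close> pos[of "v * x"] by (simp add: q_def)
        then show ?thesis using pos[of "v * x"] by (simp add: a_def)
      qed
      then have "(s0 / 2) * a \<le> (s0 / 2) * - ln (G (v * x))"
        using s0_pos by (intro mult_left_mono) auto
      then have "s \<ge> s0" using elim(2) a(1) by (simp add: s_def field_simps)
      note s = s0[OF this]
      have hv: "1 / s * (v * x) = a / 2" using a(1) \<open>x > 0\<close> \<open>v > 0\<close> by (simp add: s_def)
      have "G s \<le> 2 ^ p * (a / 2) ^ p * G (v * x)"
      proof -
        have "G ((v * x) / (a / 2)) \<le> 2 ^ p * (a / 2) ^ p * G (v * x)"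
          by (rule doubling_imp_polynomial[OF anti pos \<open>t0 > 0\<close> doubling])
             (use a(1) s in \<open>auto simp: s_def field_simps\<close>)
        then show ?thesis by (simp add: s_def mult.commute)
      qed
      also have "\<dots> \<le> 2 ^ p * a ^ p * G (v * x)"
        using a(1) pos[of "v * x"] by (intro mult_right_mono mult_left_mono power_mono) auto
      finally have "exp (1 / s * (v * x)) * measure H {s<..} \<le> exp (a / 2) * (2 ^ p * a ^ p * G (v * x))"
        unfolding hv using s by (intro mult_left_mono) auto
      also have "\<dots> = exp (a / 2) * (2 ^ p * a ^ p * exp (- a)) / n"
        using q_exp \<open>n \<ge> 1\<close> by (simp add: q_def field_simps)
      also have "\<dots> = 2 ^ p * a ^ p * exp (- a / 2) / n"
      proof -
        have "exp (a / 2) * exp (- a) = exp (- a / 2)" by (simp add: exp_add[symmetric])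
        then show ?thesis by (simp add: mult_ac)
      qed
      also have "\<dots> \<le> 1 / n" using a(2) \<open>n \<ge> 1\<close> by (intro divide_right_mono) auto
      finally have jump: "exp (1 / s * (v * x)) * measure H {s<..} \<le> 1 / n" .
      define B where "B = 1 + 1 / s * (\<gamma> * \<epsilon> / 2) + 1 / n"
      have mgf: "(\<integral>\<^sup>+y. ennreal (exp (1 / s * clip (c * x) (v * x) y)) \<partial>H) \<le> ennreal B"
      proof -
        have "(\<integral>\<^sup>+y. ennreal (exp (1 / s * clip (c * x) (v * x) y)) \<partial>H)
          \<le> ennreal (1 + 1 / s * ((\<integral>y. y \<partial>H) + ?\<rho> (c * x) + ?\<kappa> s)
              + exp (1 / s * (v * x)) * measure H {1 / (1 / s)<..})"
          by (rule clip_mgf_le[OF H(1,2)]) (use s \<open>x > 0\<close> \<open>v > 0\<close> \<open>c > 0\<close> in auto)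
        also have "\<dots> \<le> ennreal B"
          unfolding B_def using elim(3) s jump H(3)
          by (intro ennreal_leI add_mono mult_left_mono) auto
        finally show ?thesis .
      qed
      have "B \<ge> 0" using s \<open>\<gamma> > 0\<close> \<open>\<epsilon> > 0\<close> by (simp add: B_def)
      have Y: "Y i \<in> borel_measurable M" if "i \<in> {1..n}" for i
        using dom[of n] that by (auto simp: upper_orthant_dominated_def)
      have "prob {\<omega> \<in> space M. (\<Sum>i\<in>{1..n}. clip (c * x) (v * x) (Y i \<omega>)) > \<epsilon> * x}
        \<le> exp (- (1 / s) * (\<epsilon> * x)) * C * B ^ card {1..n}"
      proof (rule chernoff_sum_le)
        show "upper_orthant_dominated M C {1..n} (\<lambda>i \<omega>. exp (1 / s * clip (c * x) (v * x) (Y i \<omega>)))"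
        proof (rule upper_orthant_dominated_mono_comp[OF dom, where g = "\<lambda>y. exp (1 / s * clip (c * x) (v * x) y)"])
          show "continuous_on UNIV (\<lambda>y. exp (1 / s * clip (c * x) (v * x) y))"
            unfolding clip_def by (intro continuous_intros)
          show "mono (\<lambda>y. exp (1 / s * clip (c * x) (v * x) y))"
            using s by (auto intro!: monoI divide_right_mono simp: clip_def)
        qed (use \<open>C > 0\<close> in auto)
        show "(\<integral>\<^sup>+\<omega>. ennreal (exp (1 / s * clip (c * x) (v * x) (Y i \<omega>))) \<partial>M) \<le> ennreal B"
          if "i \<in> {1..n}" for i
        proof -
          have "(\<integral>\<^sup>+y. ennreal (exp (1 / s * clip (c * x) (v * x) y)) \<partial>distr M borel (Y i))
             = (\<integral>\<^sup>+\<omega>. ennreal (exp (1 / s * clip (c * x) (v * x) (Y i \<omega>))) \<partial>M)"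
            using Y[OF that] borel_measurable_clip by (intro nn_integral_distr) auto
          then show ?thesis using mgf distr[of i] that by simp
        qed
        show "(\<lambda>\<omega>. clip (c * x) (v * x) (Y i \<omega>)) \<in> borel_measurable M" if "i \<in> {1..n}" for i
          using Y[OF that] borel_measurable_clip by (rule measurable_compose)
      qed (use s \<open>C > 0\<close> \<open>B \<ge> 0\<close> in auto)
      also have "B ^ card {1..n} \<le> exp (1 / s * (\<epsilon> * x / 2) + 1)"
      proof -
        have "B \<le> exp (1 / s * (\<gamma> * \<epsilon> / 2) + 1 / n)"
          unfolding B_def add.assoc by (rule exp_ge_add_one_self)
        then have "B ^ n \<le> exp (1 / s * (\<gamma> * \<epsilon> / 2) + 1 / n) ^ n"
          using \<open>B \<ge> 0\<close> by (rule power_mono)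
        also have "\<dots> = exp (1 / s * ((\<gamma> * n) * \<epsilon> / 2) + 1)"
          using \<open>n \<ge> 1\<close> by (simp add: exp_of_nat_mult[symmetric] field_simps)
        also have "\<dots> \<le> exp (1 / s * (x * \<epsilon> / 2) + 1)"
          using nx s \<open>\<epsilon> > 0\<close> by (auto intro!: divide_right_mono mult_right_mono)
        finally show ?thesis by (simp add: mult.commute)
      qed
      also have "exp (- (1 / s) * (\<epsilon> * x)) * C * exp (1 / s * (\<epsilon> * x / 2) + 1)
        = C * exp 1 * exp (- (1 / s * (\<epsilon> * x / 2)))"
      proof -
        have "- (1 / s) * (\<epsilon> * x) + (1 / s * (\<epsilon> * x / 2) + 1) = 1 + - (1 / s * (\<epsilon> * x / 2))"
          by (simp add: field_simps)
        then have "exp (- (1 / s) * (\<epsilon> * x)) * exp (1 / s * (\<epsilon> * x / 2) + 1)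
          = exp 1 * exp (- (1 / s * (\<epsilon> * x / 2)))"
          by (simp only: exp_add[symmetric])
        then show ?thesis by (simp only: mult_ac)
      qed
      also have "\<dots> \<le> C * exp 1 * (q * q)"
      proof -
        have "2 * a = 1 / s * (4 * v * x)" using hv by simp
        also have "\<dots> \<le> 1 / s * (\<epsilon> * x / 2)"
          using s \<open>8 * v \<le> \<epsilon>\<close> \<open>x > 0\<close> by (intro mult_left_mono) auto
        finally have "exp (- (1 / s * (\<epsilon> * x / 2))) \<le> exp (- a + - a)" by simp
        also have "\<dots> = q * q" by (simp only: exp_add q_exp)
        finally show ?thesis using \<open>C > 0\<close> by simp
      qed
      also have "\<dots> \<le> C * exp 1 * (\<eta> / (C * exp 1 * K) * (real n * (K * G x)))"
      proof (intro mult_left_mono mult_mono)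
        show "q \<le> \<eta> / (C * exp 1 * K)" using \<open>q \<le> \<delta>\<close> by (simp add: \<delta>_def)
        have "G (x / (1 / v)) \<le> 2 ^ p * (1 / v) ^ p * G x"
          by (rule doubling_imp_polynomial[OF anti pos \<open>t0 > 0\<close> doubling])
             (use elim(5) \<open>v > 0\<close> \<open>v \<le> 1\<close> in auto)
        then show "q \<le> real n * (K * G x)"
          by (simp add: q_def K_def mult.commute[of v] mult_left_mono)
      qed (use \<open>q > 0\<close> \<open>\<eta> > 0\<close> \<open>C > 0\<close> \<open>K > 0\<close> in auto)
      also have "\<dots> = \<eta> * (real n * G x)"
        using \<open>C > 0\<close> \<open>K > 0\<close> by (simp add: field_simps)
      finally show "prob {\<omega> \<in> space M. (\<Sum>i=1..n. clip (c * x) (v * x) (Y i \<omega>)) > \<epsilon> * x} \<le> \<eta> * (real n * G x)"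
        using \<open>C > 0\<close> by (auto simp: mult_left_mono)
    qed
  qed
qed

section \<open>A single big jump\<close>

lemma (in prob_space) prob_two_exceed_le:
  fixes Y :: "nat \<Rightarrow> 'a \<Rightarrow> real"
  assumes dom: "upper_orthant_dominated M C {1..n} Y" and "C \<ge> 0"
    and u: "\<And>i. i \<in> {1..n} \<Longrightarrow> prob {\<omega> \<in> space M. Y i \<omega> > s} \<le> u"
  shows "\<And>i j. i \<in> {1..n} \<Longrightarrow> j \<in> {1..n} \<Longrightarrow> i \<noteq> j \<Longrightarrow>
      prob ({\<omega> \<in> space M. Y i \<omega> > s} \<inter> {\<omega> \<in> space M. Y j \<omega> > s}) \<le> C * u\<^sup>2"
    and "prob {\<omega> \<in> space M. \<exists>i\<in>{1..n}. \<exists>j\<in>{1..n}. i \<noteq> j \<and> Y i \<omega> > s \<and> Y j \<omega> > s}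
      \<le> (real n)\<^sup>2 * (C * u\<^sup>2)"
proof -
  have meas[measurable]: "Y i \<in> borel_measurable M" if "i \<in> {1..n}" for i
    using dom that by (auto simp: upper_orthant_dominated_def)
  let ?A = "\<lambda>i. {\<omega> \<in> space M. Y i \<omega> > s}"
  have A: "?A i \<in> events" if "i \<in> {1..n}" for i
    using meas[OF that] by measurable
  show pair: "prob (?A i \<inter> ?A j) \<le> C * u\<^sup>2" if ij: "i \<in> {1..n}" "j \<in> {1..n}" "i \<noteq> j" for i j
  proof -
    have "?A i \<inter> ?A j = {\<omega> \<in> space M. \<forall>k\<in>{i,j}. Y k \<omega> > s}" by auto
    also have "prob \<dots> \<le> C * (\<Prod>k\<in>{i,j}. prob {\<omega> \<in> space M. Y k \<omega> > s})"
      using dom ij unfolding upper_orthant_dominated_def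
      by (elim conjE allE[of _ "{i,j}"] impE) (auto dest: spec[of _ "\<lambda>_. s"])
    also have "\<dots> = C * (prob (?A i) * prob (?A j))" using ij by simp
    also have "\<dots> \<le> C * (u * u)"
      using u[OF ij(1)] u[OF ij(2)] \<open>C \<ge> 0\<close>
      by (intro mult_left_mono mult_mono) (auto intro: order_trans[OF measure_nonneg])
    finally show ?thesis by (simp add: power2_eq_square)
  qed
  let ?P = "{ij \<in> {1..n} \<times> {1..n}. fst ij \<noteq> snd ij}"
  have "finite ?P" by simp
  have "card ?P \<le> card ({1..n} \<times> {1..n})" by (rule card_mono) auto
  then have card_P: "card ?P \<le> n * n" by simp
  have "{\<omega> \<in> space M. \<exists>i\<in>{1..n}. \<exists>j\<in>{1..n}. i \<noteq> j \<and> Y i \<omega> > s \<and> Y j \<omega> > s}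
    = (\<Union>ij\<in>?P. ?A (fst ij) \<inter> ?A (snd ij))" by force
  also have "prob \<dots> \<le> (\<Sum>ij\<in>?P. prob (?A (fst ij) \<inter> ?A (snd ij)))"
    using A by (intro finite_measure_subadditive_finite) auto
  also have "\<dots> \<le> (\<Sum>ij\<in>?P. C * u\<^sup>2)"
    by (intro sum_mono pair) auto
  also have "\<dots> = real (card ?P) * (C * u\<^sup>2)" by simp
  also have "\<dots> \<le> real (n * n) * (C * u\<^sup>2)"
    using card_P \<open>C \<ge> 0\<close> by (intro mult_right_mono) (simp_all del: of_nat_mult)
  finally show "prob {\<omega> \<in> space M. \<exists>i\<in>{1..n}. \<exists>j\<in>{1..n}. i \<noteq> j \<and> Y i \<omega> > s \<and> Y j \<omega> > s}
      \<le> (real n)\<^sup>2 * (C * u\<^sup>2)"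
    by (simp add: power2_eq_square)
qed

text \<open>A crude form of Bonferroni's inequality, sufficient because the overlaps are quadratically small.\<close>

lemma (in prob_space) sum_prob_le_prob_Union:
  assumes "finite I" and "\<And>i. i \<in> I \<Longrightarrow> A i \<in> events" and "\<beta> \<ge> 0"
    and "\<And>i j. i \<in> I \<Longrightarrow> j \<in> I \<Longrightarrow> i \<noteq> j \<Longrightarrow> prob (A i \<inter> A j) \<le> \<beta>"
  shows "(\<Sum>i\<in>I. prob (A i)) \<le> prob (\<Union>i\<in>I. A i) + (real (card I))\<^sup>2 * \<beta>"
  using assms
proof (induction I rule: finite_induct)
  case empty
  then show ?case by simp
next
  case (insert k I)
  have U: "(\<Union>i\<in>I. A i) \<in> events" using insert by auto
  have "prob (A k \<inter> (\<Union>i\<in>I. A i)) = prob (\<Union>i\<in>I. A k \<inter> A i)"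
    by (rule arg_cong[of _ _ prob]) auto
  also have "\<dots> \<le> (\<Sum>i\<in>I. prob (A k \<inter> A i))"
    using insert by (intro finite_measure_subadditive_finite) auto
  also have "\<dots> \<le> (\<Sum>i\<in>I. \<beta>)" using insert by (intro sum_mono insert.prems) auto
  finally have overlap: "prob (A k \<inter> (\<Union>i\<in>I. A i)) \<le> card I * \<beta>" by simp
  have "prob (A k \<union> (\<Union>i\<in>I. A i)) = prob (A k) + prob (\<Union>i\<in>I. A i) - prob (A k \<inter> (\<Union>i\<in>I. A i))"
    using insert U by (intro measure_Un3) (auto simp: fmeasurable_eq_sets)
  moreover have "(\<Sum>i\<in>I. prob (A i)) \<le> prob (\<Union>i\<in>I. A i) + (real (card I))\<^sup>2 * \<beta>"
    using insert by (intro insert.IH) auto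
  moreover have "(real (card I))\<^sup>2 * \<beta> + card I * \<beta> \<le> (real (card (insert k I)))\<^sup>2 * \<beta>"
  proof -
    have "(real (card I))\<^sup>2 + card I \<le> (real (card (insert k I)))\<^sup>2"
      using insert.hyps by (simp add: power2_eq_square algebra_simps)
    then show ?thesis using \<open>\<beta> \<ge> 0\<close> by (metis distrib_right mult_right_mono)
  qed
  ultimately show ?case using overlap insert.hyps by simp
qed

lemma (in prob_space) prob_ex_le:
  fixes u :: real
  assumes "finite I" and "\<And>i. i \<in> I \<Longrightarrow> {\<omega> \<in> space M. P i \<omega>} \<in> events"
    and "\<And>i. i \<in> I \<Longrightarrow> prob {\<omega> \<in> space M. P i \<omega>} \<le> u"
  shows "prob {\<omega> \<in> space M. \<exists>i\<in>I. P i \<omega>} \<le> card I * u"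
proof -
  have "{\<omega> \<in> space M. \<exists>i\<in>I. P i \<omega>} = (\<Union>i\<in>I. {\<omega> \<in> space M. P i \<omega>})" by auto
  also have "prob \<dots> \<le> (\<Sum>i\<in>I. prob {\<omega> \<in> space M. P i \<omega>})"
    using assms by (intro finite_measure_subadditive_finite) auto
  also have "\<dots> \<le> (\<Sum>i\<in>I. u)" by (intro sum_mono assms)
  finally show ?thesis by simp
qed

lemma (in prob_space) prob_le_of_subset_Un3:
  assumes "E \<subseteq> A \<union> B \<union> D" and "A \<in> events" "B \<in> events" "D \<in> events"
  shows "prob E \<le> prob A + prob B + prob D"
proof -
  have "prob E \<le> prob (A \<union> B \<union> D)" using assms by (intro finite_measure_mono) auto
  also have "\<dots> \<le> prob (A \<union> B) + prob D" using assms by (intro measure_Un_le) auto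
  also have "prob (A \<union> B) \<le> prob A + prob B" using assms by (intro measure_Un_le) auto
  finally show ?thesis by simp
qed

lemma (in real_distribution) tail_eq_measure: "tail M x = prob {x<..}"
proof -
  have "prob {x<..} = prob (space M - {..x})" by (rule arg_cong[of _ _ prob]) auto
  then show ?thesis using prob_compl[of "{..x}"] by (simp add: tail_def cdf_def)
qed

lemma (in real_distribution) antimono_tail: "antimono (tail M)"
  by (auto simp: tail_def intro!: antimonoI cdf_nondecreasing)

text \<open>The common distribution enters through the doubling constants \<open>p\<close>, \<open>t0\<close> of its tail, and the
dependence through the constant \<open>C\<close>, which serves for \<open>X\<close> and for \<open>- X\<close> alike.\<close>

locale dominated_sums = prob_space M for M :: "'a measure" +
  fixes X :: "nat \<Rightarrow> 'a \<Rightarrow> real" and F :: "real measure" and C :: real and p :: nat and t0 :: real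
  assumes F: "real_distribution F" and F_int: "integrable F (\<lambda>y. y)" and F_mean: "(\<integral>y. y \<partial>F) = 0"
    and tail_pos: "\<And>x. tail F x > 0" and t0_pos: "t0 > 0"
    and doubling: "\<And>t. t \<ge> t0 \<Longrightarrow> tail F (t / 2) \<le> 2 ^ p * tail F t"
    and left_tail: "(\<lambda>x. cdf F (- x)) \<in> o[at_top](tail F)"
    and C_pos: "C > 0"
    and dom: "\<And>n. upper_orthant_dominated M C {1..n} X"
    and dom_minus: "\<And>n. upper_orthant_dominated M C {1..n} (\<lambda>i \<omega>. - X i \<omega>)"
    and distr: "\<And>i. i \<ge> 1 \<Longrightarrow> distr M borel (X i) = F"
begin

lemma X_meas [measurable]: "i \<ge> 1 \<Longrightarrow> X i \<in> borel_measurable M"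
  using dom[of i] by (auto simp: upper_orthant_dominated_def)

lemma antimono_tail_F: "antimono (tail F)"
  using real_distribution.antimono_tail[OF F] .

lemma prob_X_greater: "i \<ge> 1 \<Longrightarrow> prob {\<omega> \<in> space M. X i \<omega> > s} = tail F s"
proof -
  assume i: "i \<ge> 1"
  have "tail F s = measure (distr M borel (X i)) {s<..}"
    using distr[OF i] real_distribution.tail_eq_measure[OF F] by simp
  also have "\<dots> = prob (X i -` {s<..} \<inter> space M)"
    using i by (intro measure_distr) auto
  also have "X i -` {s<..} \<inter> space M = {\<omega> \<in> space M. X i \<omega> > s}" by auto
  finally show ?thesis by simp
qed

lemma prob_minus_X_greater_le: "i \<ge> 1 \<Longrightarrow> prob {\<omega> \<in> space M. - X i \<omega> > s} \<le> cdf F (- s)"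
proof -
  assume i: "i \<ge> 1"
  have "prob {\<omega> \<in> space M. - X i \<omega> > s} \<le> prob (X i -` {..- s} \<inter> space M)"
    using i by (intro finite_measure_mono) auto
  also have "\<dots> = measure (distr M borel (X i)) {..- s}"
    using i by (intro measure_distr[symmetric]) auto
  finally show ?thesis using distr[OF i] by (simp add: cdf_def)
qed

lemma mult_tail_tendsto_0: "((\<lambda>t. t * tail F t) \<longlongrightarrow> 0) at_top"
  using integrable_mult_tail_tendsto_0[OF F F_int] by (simp add: real_distribution.tail_eq_measure[OF F])

lemma left_tail_le:
  assumes "\<epsilon> > 0" shows "\<forall>\<^sub>F x in at_top. cdf F (- x) \<le> \<epsilon> * tail F x"
  using landau_o.smallD[OF left_tail assms]
  by eventually_elim (use tail_pos in \<open>simp add: abs_of_pos cdf_def\<close>)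

lemma eventually_tail_scale:
  assumes "0 < v" "v \<le> 1"
  obtains K where "K > 0" "\<forall>\<^sub>F x in at_top. tail F (v * x) \<le> K * tail F x"
proof
  show "2 ^ p * (1 / v) ^ p > 0" using \<open>v > 0\<close> by simp
  show "\<forall>\<^sub>F x in at_top. tail F (v * x) \<le> 2 ^ p * (1 / v) ^ p * tail F x"
    using eventually_ge_at_top[of "1 / v * t0"]
  proof eventually_elim
    case (elim x)
    then show ?case
      using doubling_imp_polynomial[OF antimono_tail_F tail_pos t0_pos doubling, of "1 / v" x] assms
      by (simp add: mult.commute)
  qed
qed

text \<open>Two big jumps: \<open>(n * tail F x)\<^sup>2\<close> is of smaller order than \<open>n * tail F x\<close> uniformly in
\<open>n \<le> x / \<gamma>\<close>, because \<open>x * tail F x\<close> tends to 0.\<close>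

lemma eventually_pairs_negligible:
  assumes "0 < v" "v \<le> 1" "\<gamma> > 0" "\<eta> > 0"
  shows "\<forall>\<^sub>F x in at_top. \<forall>n\<ge>1. \<gamma> * real n \<le> x \<longrightarrow>
    (real n)\<^sup>2 * (C * (tail F (v * x))\<^sup>2) \<le> \<eta> * (real n * tail F x)"
proof -
  obtain K where K: "K > 0" "\<forall>\<^sub>F x in at_top. tail F (v * x) \<le> K * tail F x"
    using eventually_tail_scale assms by blast
  have "((\<lambda>x. (v * x) * tail F (v * x)) \<longlongrightarrow> 0) at_top"
    using mult_tail_tendsto_0 filterlim_mult_at_top[OF \<open>v > 0\<close>] by (rule filterlim_compose)
  then have "\<forall>\<^sub>F x in at_top. (v * x) * tail F (v * x) < v * \<gamma> * (\<eta> / (C * K))"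
    by (rule order_tendstoD) (use assms C_pos K in simp)
  then show ?thesis using K(2)
  proof eventually_elim
    case (elim x)
    show ?case
    proof (intro allI impI)
      fix n :: nat assume "n \<ge> 1" and nx: "\<gamma> * real n \<le> x"
      let ?T = "tail F (v * x)"
      have "?T > 0" using tail_pos .
      have "v * \<gamma> * (real n * ?T) = v * ((\<gamma> * real n) * ?T)" by simp
      also have "\<dots> \<le> v * (x * ?T)"
        using nx assms \<open>?T > 0\<close> by (intro mult_left_mono mult_right_mono) auto
      also have "\<dots> \<le> v * \<gamma> * (\<eta> / (C * K))" using elim(1) by (simp add: mult.assoc)
      finally have "real n * ?T \<le> \<eta> / (C * K)"
        by (rule mult_left_le_imp_le) (use assms in simp)
      then have "C * K * (real n * ?T) \<le> \<eta>" using C_pos K by (simp add: field_simps)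
      then have "(C * K * (real n * ?T)) * (real n * tail F x) \<le> \<eta> * (real n * tail F x)"
        using tail_pos[of x] by (intro mult_right_mono) auto
      moreover have "(real n)\<^sup>2 * (C * ?T\<^sup>2) \<le> (C * K * (real n * ?T)) * (real n * tail F x)"
      proof -
        have "(real n)\<^sup>2 * C * ?T * ?T \<le> (real n)\<^sup>2 * C * ?T * (K * tail F x)"
          using elim(2) C_pos \<open>?T > 0\<close> by (intro mult_left_mono) auto
        then show ?thesis by (simp add: power2_eq_square mult_ac)
      qed
      ultimately show "(real n)\<^sup>2 * (C * ?T\<^sup>2) \<le> \<eta> * (real n * tail F x)" by linarith
    qed
  qed
qed

text \<open>If \<open>S > x\<close>, then some summand exceeds \<open>x / y\<close>, or two of them exceed \<open>v * x\<close>, or at most one of them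
does and the others have a sum above \<open>(1 - 1 / y) * x\<close> already.  In the last case the sum of the clipped
variables is large, since the exceptional summand is clipped to a nonnegative value.  Only the first
event has a probability of the order of \<open>n * tail F x\<close>.\<close>

lemma eventually_sum_tail_le:
  assumes "y > 1" "r > 0" "\<gamma> > 0" "\<eta> > 0"
    and ev: "\<forall>\<^sub>F x in at_top. r * tail F x \<le> tail F (x * y)"
  shows "\<forall>\<^sub>F x in at_top. \<forall>n\<ge>1. \<gamma> * real n \<le> x \<longrightarrow>
    prob {\<omega> \<in> space M. (\<Sum>k=1..n. X k \<omega>) > x} \<le> (1 / r + \<eta>) * (real n * tail F x)"
proof -
  define \<delta> where "\<delta> = 1 - 1 / y"
  have \<delta>: "0 < \<delta>" "\<delta> < 1" using \<open>y > 1\<close> by (auto simp: \<delta>_def)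
  define v where "v = \<delta> / 8"
  have v: "0 < v" "v \<le> 1" "8 * v \<le> \<delta>" using \<delta> by (auto simp: v_def)
  have HG: "\<forall>\<^sub>F t in at_top. measure F {t<..} \<le> tail F t"
    by (simp add: real_distribution.tail_eq_measure[OF F])
  have "\<eta> / 2 > 0" using \<open>\<eta> > 0\<close> by simp
  have trunc: "\<forall>\<^sub>F x in at_top. \<forall>n\<ge>1. \<gamma> * real n \<le> x \<longrightarrow>
      prob {\<omega> \<in> space M. (\<Sum>i=1..n. clip (1 * x) (v * x) (X i \<omega>)) > \<delta> * x} \<le> \<eta> / 2 * (real n * tail F x)"
    by (rule truncated_sum_negligible[OF F F_int F_mean antimono_tail_F tail_pos t0_pos doubling
          mult_tail_tendsto_0 HG dom C_pos distr \<open>\<gamma> > 0\<close> zero_less_one v \<open>\<eta> / 2 > 0\<close>])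
  have "\<forall>\<^sub>F x in at_top. r * tail F ((1 / y) * x) \<le> tail F ((1 / y) * x * y)"
    by (rule eventually_compose_filterlim[OF ev filterlim_mult_at_top]) (use \<open>y > 1\<close> in simp)
  then have big: "\<forall>\<^sub>F x in at_top. tail F (x / y) \<le> 1 / r * tail F x"
    by eventually_elim (use \<open>y > 1\<close> \<open>r > 0\<close> in \<open>simp add: field_simps\<close>)
  show ?thesis
    using trunc big eventually_pairs_negligible[OF v(1,2) \<open>\<gamma> > 0\<close> \<open>\<eta> / 2 > 0\<close>] eventually_gt_at_top[of 0]
  proof eventually_elim
    case (elim x)
    show ?case
    proof (intro allI impI)
      fix n :: nat assume n: "n \<ge> 1" "\<gamma> * real n \<le> x"
      have [measurable]: "X i \<in> borel_measurable M" if "i \<in> {1..n}" for i using that by auto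
      let ?A = "{\<omega> \<in> space M. \<exists>i\<in>{1..n}. X i \<omega> > x / y}"
      let ?B = "{\<omega> \<in> space M. \<exists>i\<in>{1..n}. \<exists>j\<in>{1..n}. i \<noteq> j \<and> X i \<omega> > v * x \<and> X j \<omega> > v * x}"
      let ?D = "{\<omega> \<in> space M. (\<Sum>i=1..n. clip (1 * x) (v * x) (X i \<omega>)) > \<delta> * x}"
      have "prob {\<omega> \<in> space M. (\<Sum>k=1..n. X k \<omega>) > x} \<le> prob ?A + prob ?B + prob ?D"
      proof (rule prob_le_of_subset_Un3)
        show "{\<omega> \<in> space M. (\<Sum>k=1..n. X k \<omega>) > x} \<subseteq> ?A \<union> ?B \<union> ?D"
        proof (rule subsetI, rule ccontr)
          fix \<omega> assume S: "\<omega> \<in> {\<omega> \<in> space M. (\<Sum>k=1..n. X k \<omega>) > x}"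
            and "\<omega> \<notin> ?A \<union> ?B \<union> ?D"
          then have D: "\<omega> \<notin> ?D" and AB: "\<omega> \<notin> ?A \<union> ?B" by blast+
          let ?c = "\<lambda>i. clip (1 * x) (v * x) (X i \<omega>)"
          have le_A: "X i \<omega> \<le> x / y" if "i \<in> {1..n}" for i
            using AB S that by (auto simp: not_less)
          have one: "i = j" if "i \<in> {1..n}" "j \<in> {1..n}" "X i \<omega> > v * x" "X j \<omega> > v * x" for i j
            using AB S that unfolding mem_Collect_eq Un_iff by blast
          have c: "X i \<omega> \<le> ?c i" if "X i \<omega> \<le> v * x" for i using that by (auto simp: clip_def)
          have "\<delta> * x < (\<Sum>i=1..n. ?c i)"
          proof (cases "\<exists>k\<in>{1..n}. X k \<omega> > v * x")
            case True
            then obtain k where k: "k \<in> {1..n}" "X k \<omega> > v * x" by auto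
            have "0 \<le> v * x" using v elim(4) by simp
            then have "0 \<le> ?c k" using k by (simp add: clip_def)
            have "(\<Sum>i=1..n. X i \<omega>) = X k \<omega> + (\<Sum>i\<in>{1..n} - {k}. X i \<omega>)"
              using k by (intro sum.remove) auto
            also have "\<dots> \<le> x / y + (\<Sum>i\<in>{1..n} - {k}. ?c i)"
            proof (intro add_mono sum_mono c le_A k)
              fix i assume "i \<in> {1..n} - {k}"
              then show "X i \<omega> \<le> v * x" using one[of i k] k by (auto simp: not_less[symmetric])
            qed
            also have "\<dots> \<le> x / y + (?c k + (\<Sum>i\<in>{1..n} - {k}. ?c i))" using \<open>0 \<le> ?c k\<close> by simp
            also have "?c k + (\<Sum>i\<in>{1..n} - {k}. ?c i) = (\<Sum>i=1..n. ?c i)"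
              using k by (intro sum.remove[symmetric]) auto
            finally have "x < x / y + (\<Sum>i=1..n. ?c i)" using S by auto
            then show ?thesis by (simp add: \<delta>_def algebra_simps)
          next
            case False
            then have "(\<Sum>i=1..n. X i \<omega>) \<le> (\<Sum>i=1..n. ?c i)"
              by (intro sum_mono c) (auto simp: not_less)
            moreover have "\<delta> * x \<le> x" using \<delta> elim(4) by simp
            ultimately show ?thesis using S by auto
          qed
          then show False using D S by auto
        qed
      qed measurable
      moreover have "prob ?A \<le> card {1..n} * tail F (x / y)"
        by (rule prob_ex_le) (auto simp: prob_X_greater)
      moreover have "prob ?B \<le> (real n)\<^sup>2 * (C * (tail F (v * x))\<^sup>2)"
        by (rule prob_two_exceed_le(2)[OF dom]) (use C_pos in \<open>auto simp: prob_X_greater\<close>)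
      moreover have "real n * tail F (x / y) \<le> real n * (1 / r * tail F x)"
        using elim(2) by (intro mult_left_mono) auto
      moreover note elim(1)[rule_format, OF n] elim(3)[rule_format, OF n]
      ultimately show "prob {\<omega> \<in> space M. (\<Sum>k=1..n. X k \<omega>) > x} \<le> (1 / r + \<eta>) * (real n * tail F x)"
        by (simp add: algebra_simps)
    qed
  qed
qed

text \<open>If some \<open>X k > x * y\<close> but \<open>S \<le> x\<close>, the other summands have a sum below \<open>- (y - 1) * x\<close>.  Either one
of them is below \<open>- v * x\<close>, which has negligible probability by the assumption on the left tail, or
the clipped versions of \<open>- X i\<close> have a large sum.  Orthant dependence does not control the joint law of
one large summand and a very negative rest; therefore \<open>- X k\<close>, clipped from below at \<open>- \<delta> * x\<close>, is kept
in a sum over all indices.\<close>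

lemma eventually_sum_tail_ge:
  assumes "y > 1" "r > 0" "\<gamma> > 0" "\<eta> > 0"
    and ev: "\<forall>\<^sub>F x in at_top. r * tail F x \<le> tail F (x * y)"
  shows "\<forall>\<^sub>F x in at_top. \<forall>n\<ge>1. \<gamma> * real n \<le> x \<longrightarrow>
    (r - \<eta>) * (real n * tail F x) \<le> prob {\<omega> \<in> space M. (\<Sum>k=1..n. X k \<omega>) > x}"
proof -
  \<comment> \<open>Half of the gap \<open>(y - 1) * x\<close> is spent on the lower clipping level, half on the deviation.\<close>
  define \<delta> where "\<delta> = (y - 1) / 2"
  have \<delta>: "0 < \<delta>" using \<open>y > 1\<close> by (auto simp: \<delta>_def)
  define v where "v = min 1 (\<delta> / 8)"
  have v: "0 < v" "v \<le> 1" "8 * v \<le> \<delta>" using \<delta> by (auto simp: v_def)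
  let ?H = "distr F borel uminus"
  interpret F: real_distribution F by (rule F)
  have neg: "uminus \<in> borel_measurable F"
    using borel_measurable_uminus[of "\<lambda>y. y" F] by simp
  have H: "real_distribution ?H" using neg by (rule F.real_distribution_distr)
  have H_int: "integrable ?H (\<lambda>y. y)"
  proof -
    have "integrable ?H (\<lambda>y. y) \<longleftrightarrow> integrable F (\<lambda>y. - y)"
      using neg by (rule integrable_distr_eq) simp
    then show ?thesis using F_int by simp
  qed
  have H_mean: "(\<integral>y. y \<partial>?H) = 0"
  proof -
    have "(\<integral>y. y \<partial>?H) = (\<integral>y. - y \<partial>F)"
      using neg by (rule integral_distr) simp
    then show ?thesis using F_mean by simp
  qed
  have H_tail: "\<forall>\<^sub>F t in at_top. measure ?H {t<..} \<le> tail F t"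
    using left_tail_le[OF zero_less_one]
  proof eventually_elim
    case (elim t)
    have "measure ?H {t<..} = measure F (uminus -` {t<..} \<inter> space F)"
      using neg by (rule measure_distr) simp
    also have "\<dots> \<le> measure F {..- t}" by (intro F.finite_measure_mono) auto
    finally show ?case using elim by (simp add: cdf_def)
  qed
  have H_distr: "distr M borel (\<lambda>\<omega>. - X i \<omega>) = ?H" if "i \<ge> 1" for i
  proof -
    have "distr F borel uminus = distr (distr M borel (X i)) borel uminus" using distr[OF that] by simp
    also have "\<dots> = distr M borel (uminus \<circ> X i)" using that by (intro distr_distr X_meas) auto
    finally show ?thesis by (simp add: comp_def)
  qed
  have "\<eta> / 3 > 0" using \<open>\<eta> > 0\<close> by simp
  have trunc: "\<forall>\<^sub>F x in at_top. \<forall>n\<ge>1. \<gamma> * real n \<le> x \<longrightarrow>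
      prob {\<omega> \<in> space M. (\<Sum>i=1..n. clip (\<delta> * x) (v * x) (- X i \<omega>)) > \<delta> * x} \<le> \<eta> / 3 * (real n * tail F x)"
    by (rule truncated_sum_negligible[OF H H_int H_mean antimono_tail_F tail_pos t0_pos doubling
          mult_tail_tendsto_0 H_tail dom_minus C_pos H_distr \<open>\<gamma> > 0\<close> \<delta> v \<open>\<eta> / 3 > 0\<close>])
  obtain K where K: "K > 0" "\<forall>\<^sub>F x in at_top. tail F (v * x) \<le> K * tail F x"
    using eventually_tail_scale v by blast
  have "\<eta> / (3 * K) > 0" using \<open>\<eta> > 0\<close> K by simp
  have "\<forall>\<^sub>F x in at_top. cdf F (- (v * x)) \<le> \<eta> / (3 * K) * tail F (v * x)"
    using left_tail_le[OF \<open>\<eta> / (3 * K) > 0\<close>] filterlim_mult_at_top[OF v(1)]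
    by (rule eventually_compose_filterlim)
  then have left: "\<forall>\<^sub>F x in at_top. cdf F (- (v * x)) \<le> \<eta> / 3 * tail F x"
    using K(2)
  proof eventually_elim
    case (elim x)
    have "\<eta> / (3 * K) * tail F (v * x) \<le> \<eta> / (3 * K) * (K * tail F x)"
      using elim(2) \<open>\<eta> / (3 * K) > 0\<close> by (intro mult_left_mono) auto
    then show ?case using elim(1) K(1) by simp
  qed
  show ?thesis
    using trunc left ev eventually_pairs_negligible[OF zero_less_one order_refl \<open>\<gamma> > 0\<close> \<open>\<eta> / 3 > 0\<close>]
      eventually_gt_at_top[of 0]
  proof eventually_elim
    case (elim x)
    show ?case
    proof (intro allI impI)
      fix n :: nat assume n: "n \<ge> 1" "\<gamma> * real n \<le> x"
      have [measurable]: "X i \<in> borel_measurable M" if "i \<in> {1..n}" for i using that by auto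
      let ?A = "{\<omega> \<in> space M. (\<Sum>k=1..n. X k \<omega>) > x}"
      let ?B = "{\<omega> \<in> space M. \<exists>i\<in>{1..n}. - X i \<omega> > v * x}"
      let ?D = "{\<omega> \<in> space M. (\<Sum>i=1..n. clip (\<delta> * x) (v * x) (- X i \<omega>)) > \<delta> * x}"
      let ?E = "\<lambda>i. {\<omega> \<in> space M. X i \<omega> > x * y}"
      have E_meas: "?E i \<in> events" if "i \<in> {1..n}" for i using that by measurable
      have "prob (\<Union>i\<in>{1..n}. ?E i) \<le> prob ?A + prob ?B + prob ?D"
      proof (rule prob_le_of_subset_Un3)
        show "(\<Union>i\<in>{1..n}. ?E i) \<subseteq> ?A \<union> ?B \<union> ?D"
        proof (rule subsetI, rule ccontr)
          fix \<omega> assume E: "\<omega> \<in> (\<Union>i\<in>{1..n}. ?E i)" and "\<omega> \<notin> ?A \<union> ?B \<union> ?D"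
          then have D: "\<omega> \<notin> ?D" and AB: "\<omega> \<notin> ?A \<union> ?B" by blast+
          let ?c = "\<lambda>i. clip (\<delta> * x) (v * x) (- X i \<omega>)"
          obtain k where k: "k \<in> {1..n}" "X k \<omega> > x * y" and "\<omega> \<in> space M" using E by auto
          have c: "- X i \<omega> \<le> ?c i" if "i \<in> {1..n}" for i
          proof -
            have "- X i \<omega> \<le> v * x" using AB that \<open>\<omega> \<in> space M\<close> by (auto simp: not_less)
            then show ?thesis by (auto simp: clip_def)
          qed
          have "(\<Sum>i=1..n. X i \<omega>) \<le> x" using AB \<open>\<omega> \<in> space M\<close> by auto
          moreover have "(\<Sum>i=1..n. X i \<omega>) = X k \<omega> + (\<Sum>i\<in>{1..n} - {k}. X i \<omega>)"
            using k by (intro sum.remove) auto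
          moreover have "(\<Sum>i=1..n. ?c i) = ?c k + (\<Sum>i\<in>{1..n} - {k}. ?c i)"
            using k by (intro sum.remove) auto
          moreover have "(\<Sum>i\<in>{1..n} - {k}. - X i \<omega>) \<le> (\<Sum>i\<in>{1..n} - {k}. ?c i)"
            by (intro sum_mono c) auto
          moreover have "- (\<delta> * x) \<le> ?c k" by (simp add: clip_def)
          moreover have "x * y = x + 2 * (\<delta> * x)" by (simp add: \<delta>_def field_simps)
          ultimately have "\<delta> * x < (\<Sum>i=1..n. ?c i)" using k by (simp add: sum_negf)
          then show False using D \<open>\<omega> \<in> space M\<close> by auto
        qed
      qed measurable
      moreover have "(\<Sum>i\<in>{1..n}. prob (?E i))
        \<le> prob (\<Union>i\<in>{1..n}. ?E i) + (real (card {1..n}))\<^sup>2 * (C * (tail F (1 * x))\<^sup>2)"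
      proof (rule sum_prob_le_prob_Union)
        fix i j assume ij: "i \<in> {1..n}" "j \<in> {1..n}" "i \<noteq> j"
        show "prob (?E i \<inter> ?E j) \<le> C * (tail F (1 * x))\<^sup>2"
        proof (rule prob_two_exceed_le(1)[OF dom _ _ ij])
          show "prob (?E i) \<le> tail F (1 * x)" if "i \<in> {1..n}" for i
            using that antimonoD[OF antimono_tail_F, of "1 * x" "x * y"] elim(5) \<open>y > 1\<close>
            by (simp add: prob_X_greater)
        qed (use C_pos in auto)
      qed (use C_pos E_meas in auto)
      moreover have "(\<Sum>i\<in>{1..n}. prob (?E i)) = real n * tail F (x * y)"
        by (simp add: prob_X_greater)
      moreover have "real n * (r * tail F x) \<le> real n * tail F (x * y)"
        using elim(3) by (intro mult_left_mono) auto
      moreover have "prob ?B \<le> card {1..n} * (\<eta> / 3 * tail F x)"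
      proof (rule prob_ex_le)
        show "prob {\<omega> \<in> space M. - X i \<omega> > v * x} \<le> \<eta> / 3 * tail F x" if "i \<in> {1..n}" for i
          using that by (intro order_trans[OF prob_minus_X_greater_le elim(2)]) simp
      qed auto
      moreover note elim(1)[rule_format, OF n] elim(4)[rule_format, OF n]
      ultimately show "(r - \<eta>) * (real n * tail F x) \<le> prob ?A"
        by (simp add: algebra_simps)
    qed
  qed
qed

end

section \<open>The index of a dominatedly varying tail\<close>

context
  fixes F :: "real measure"
  assumes F: "real_distribution F" and tail_pos: "\<And>x. 0 < tail F x"
begin

lemma tail_liminf_antimono:
  assumes "y \<le> z"
  shows "tail_liminf F z \<le> tail_liminf F y"
  unfolding tail_liminf_def
proof (rule Liminf_mono)
  show "\<forall>\<^sub>F x in at_top. ereal (tail F (x * z) / tail F x) \<le> ereal (tail F (x * y) / tail F x)"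
    using eventually_ge_at_top[of 0]
  proof eventually_elim
    case (elim x)
    have "x * y \<le> x * z" using elim assms by (rule mult_left_mono[rotated])
    then have "tail F (x * z) \<le> tail F (x * y)"
      by (rule antimonoD[OF real_distribution.antimono_tail[OF F]])
    then show ?case using tail_pos[of x] by (simp add: divide_right_mono)
  qed
qed

text \<open>Since \<open>tail_liminf F\<close> is antimonotone, its right limit at 1 exists and is a supremum.\<close>

lemma L_index_eq_SUP: "L_index F = (SUP y\<in>{1<..}. tail_liminf F y)"
proof -
  let ?L = "SUP y\<in>{1<..}. tail_liminf F y"
  have upper: "tail_liminf F y \<le> ?L" if "y > 1" for y
    using that by (intro SUP_upper) auto
  have "(tail_liminf F \<longlongrightarrow> ?L) (at_right 1)"
  proof (rule order_tendstoI)
    fix a assume "a < ?L"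
    then obtain z where z: "z > 1" "a < tail_liminf F z" by (auto simp: less_SUP_iff)
    have "\<forall>\<^sub>F y in at_right 1. y < z" using eventually_at_right_less z(1)
      by (auto simp: eventually_at_right_field)
    then show "\<forall>\<^sub>F y in at_right 1. a < tail_liminf F y"
      by eventually_elim (use z tail_liminf_antimono in \<open>meson less_imp_le less_le_trans\<close>)
  next
    fix a assume "?L < a"
    show "\<forall>\<^sub>F y in at_right 1. tail_liminf F y < a"
      using eventually_at_right_less[of "1::real"]
      by eventually_elim (use upper \<open>?L < a\<close> in \<open>meson le_less_trans\<close>)
  qed
  then show ?thesis unfolding L_index_def by (intro tendsto_Lim) auto
qed

lemma L_index_le_1: "L_index F \<le> 1"
  unfolding L_index_eq_SUP
proof (rule SUP_least)
  fix y :: real assume "y \<in> {1<..}"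
  then have "tail_limsup F y \<le> 1" using tail_limsup_le_1[OF F tail_pos] by simp
  moreover have "tail_liminf F y \<le> tail_limsup F y"
    unfolding tail_liminf_def tail_limsup_def by (rule Liminf_le_Limsup) simp
  ultimately show "tail_liminf F y \<le> 1" by simp
qed

text \<open>The only way in which the index enters the probabilistic estimates: both bounds for the ratio are
derived from one lower bound \<open>r\<close> for \<open>tail F (x * y) / tail F x\<close>, the upper one by evaluating it
at \<open>x / y\<close>.\<close>

lemma less_L_indexD:
  assumes "ereal r < L_index F"
  obtains y where "y > 1" "\<forall>\<^sub>F x in at_top. r * tail F x \<le> tail F (x * y)"
proof -
  obtain y where y: "y > 1" "ereal r < tail_liminf F y"
    using assms by (auto simp: L_index_eq_SUP less_SUP_iff)
  have "\<forall>\<^sub>F x in at_top. ereal r < ereal (tail F (x * y) / tail F x)"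
    using y(2) unfolding tail_liminf_def by (rule less_LiminfD)
  then have "\<forall>\<^sub>F x in at_top. r * tail F x \<le> tail F (x * y)"
    by eventually_elim (use tail_pos in \<open>auto simp: pos_less_divide_eq less_imp_le\<close>)
  with y(1) show ?thesis by (rule that)
qed

lemma L_index_pos:
  assumes "\<And>t. t \<ge> t0 \<Longrightarrow> tail F (t / 2) \<le> 2 ^ p * tail F t"
  shows "0 < L_index F"
proof -
  have "(0::ereal) < ereal (1 / 2 ^ p)" by simp
  also have "\<dots> \<le> tail_liminf F 2"
    unfolding tail_liminf_def
  proof (rule Liminf_bounded)
    show "\<forall>\<^sub>F x in at_top. ereal (1 / 2 ^ p) \<le> ereal (tail F (x * 2) / tail F x)"
      using eventually_ge_at_top[of "t0 / 2"]
    proof eventually_elim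
      case (elim x)
      have "tail F ((x * 2) / 2) \<le> 2 ^ p * tail F (x * 2)" using elim by (intro assms) simp
      then show ?case using tail_pos[of x] by (simp add: field_simps)
    qed
  qed
  also have "\<dots> \<le> L_index F" unfolding L_index_eq_SUP by (rule SUP_upper) simp
  finally show ?thesis .
qed

end

text \<open>The bound for the tail ratio at \<open>1 / 2\<close>, rounded up to a power of two so that it iterates to a
polynomial of natural degree.\<close>

lemma dominatedly_varying_doubling:
  assumes "F \<in> dominatedly_varying"
  obtains p t0 where "t0 > 0" "\<And>t. t \<ge> t0 \<Longrightarrow> tail F (t / 2) \<le> 2 ^ p * tail F t"
proof -
  have pos: "tail F x > 0" for x using assms by (simp add: dominatedly_varying_def)
  have "tail_limsup F (1 / 2) < \<infinity>" using assms by (simp add: dominatedly_varying_def)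
  then obtain p :: nat where "tail_limsup F (1 / 2) < ereal (real p)"
    using less_PInf_Ex_of_nat by auto
  then have "\<forall>\<^sub>F x in at_top. ereal (tail F (x * (1 / 2)) / tail F x) < ereal (real p)"
    unfolding tail_limsup_def by (rule Limsup_lessD)
  then have "\<forall>\<^sub>F x in at_top. tail F (x / 2) \<le> 2 ^ p * tail F x"
  proof eventually_elim
    case (elim x)
    then have "tail F (x / 2) \<le> real p * tail F x" using pos[of x] by (simp add: field_simps)
    also have "\<dots> \<le> 2 ^ p * tail F x"
      using pos[of x] of_nat_less_two_power[of p, where ?'a = real] by (intro mult_right_mono) auto
    finally show ?case .
  qed
  then have "\<forall>\<^sub>F x in at_top. x > 0 \<and> tail F (x / 2) \<le> 2 ^ p * tail F x"
    using eventually_gt_at_top[of 0] by eventually_elim auto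
  then obtain t0 where "\<And>t. t \<ge> t0 \<Longrightarrow> t > 0 \<and> tail F (t / 2) \<le> 2 ^ p * tail F t"
    by (auto simp: eventually_at_top_linorder)
  then show ?thesis using that[of t0 p] by blast
qed

section \<open>Precise large deviations\<close>

lemma (in dominated_sums) eventually_ratio_bounds:
  assumes L: "L_index F = ereal l" and "l > 0" "\<gamma> > 0" "e > 0"
  shows "\<forall>\<^sub>F n in sequentially. \<forall>x\<ge>\<gamma> * real n. l - e \<le> ratio M X F n x \<and> ratio M X F n x \<le> 1 / l + e"
proof -
  \<comment> \<open>Some \<open>r < l\<close> is so close to \<open>l\<close> that both errors stay below \<open>e / 2\<close>.\<close>
  have "((\<lambda>r. 1 / r) \<longlongrightarrow> 1 / l) (at_left l)"
    using \<open>l > 0\<close> by (intro tendsto_intros) auto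
  then have "\<forall>\<^sub>F r in at_left l. 1 / r < 1 / l + e / 2"
    by (rule order_tendstoD) (use \<open>e > 0\<close> in simp)
  moreover have "\<forall>\<^sub>F r in at_left l. max 0 (l - e / 2) < r \<and> r < l"
    using eventually_at_left_real[of "max 0 (l - e / 2)" l] \<open>l > 0\<close> \<open>e > 0\<close> by simp
  ultimately have "\<forall>\<^sub>F r in at_left l. 1 / r < 1 / l + e / 2 \<and> max 0 (l - e / 2) < r \<and> r < l"
    by eventually_elim auto
  then obtain r where r: "1 / r < 1 / l + e / 2" "0 < r" "l - e / 2 < r" "r < l"
    using eventually_happens[of _ "at_left l"] by auto
  obtain y where y: "y > 1" "\<forall>\<^sub>F x in at_top. r * tail F x \<le> tail F (x * y)"
    using less_L_indexD[OF F tail_pos, of r] r(4) L by auto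
  have "e / 2 > 0" using \<open>e > 0\<close> by simp
  have "\<forall>\<^sub>F x in at_top. \<forall>n\<ge>1. \<gamma> * real n \<le> x \<longrightarrow> l - e \<le> ratio M X F n x \<and> ratio M X F n x \<le> 1 / l + e"
    using eventually_sum_tail_le[OF y(1) r(2) \<open>\<gamma> > 0\<close> \<open>e / 2 > 0\<close> y(2)]
      eventually_sum_tail_ge[OF y(1) r(2) \<open>\<gamma> > 0\<close> \<open>e / 2 > 0\<close> y(2)]
  proof eventually_elim
    case (elim x)
    show ?case
    proof (intro allI impI)
      fix n :: nat assume n: "n \<ge> 1" "\<gamma> * real n \<le> x"
      have "0 < real n * tail F x" using n tail_pos[of x] by simp
      then have "r - e / 2 \<le> ratio M X F n x" "ratio M X F n x \<le> 1 / r + e / 2"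
        using elim(1)[rule_format, OF n] elim(2)[rule_format, OF n]
        unfolding ratio_def by (simp_all only: pos_le_divide_eq pos_divide_le_eq)
      then show "l - e \<le> ratio M X F n x \<and> ratio M X F n x \<le> 1 / l + e" using r by linarith
    qed
  qed
  then obtain x0 where x0: "\<And>x n. x \<ge> x0 \<Longrightarrow> n \<ge> 1 \<Longrightarrow> \<gamma> * real n \<le> x \<Longrightarrow>
      l - e \<le> ratio M X F n x \<and> ratio M X F n x \<le> 1 / l + e"
    by (auto simp: eventually_at_top_linorder)
  have "\<forall>\<^sub>F n in sequentially. x0 \<le> \<gamma> * real n"
    using filterlim_compose[OF filterlim_mult_at_top[OF \<open>\<gamma> > 0\<close>] filterlim_real_sequentially]
    by (auto simp: filterlim_at_top)
  then show ?thesis using eventually_ge_at_top[of 1]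
    by eventually_elim (use x0 in force)
qed

theorem theorem1p1:
  fixes M :: "'a measure" and X :: "nat \<Rightarrow> 'a \<Rightarrow> real" and F :: "real measure"
  assumes "prob_space M"
    and "ENOD M X"
    and "\<And>i. i \<ge> 1 \<Longrightarrow> distr M borel (X i) = F"
    and "F \<in> dominatedly_varying"
    and "integrable M (X 1)"
    and "integral\<^sup>L M (X 1) = 0"
    and "(\<lambda>x. cdf F (- x)) \<in> o[at_top](tail F)"
  shows "(\<forall>\<gamma>>0.
            L_index F \<le> liminf (\<lambda>n. INF x\<in>{\<gamma> * real n..}. ereal (ratio M X F n x)) \<and>
            liminf (\<lambda>n. INF x\<in>{\<gamma> * real n..}. ereal (ratio M X F n x))
              \<le> limsup (\<lambda>n. SUP x\<in>{\<gamma> * real n..}. ereal (ratio M X F n x)) \<and>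
            limsup (\<lambda>n. SUP x\<in>{\<gamma> * real n..}. ereal (ratio M X F n x)) \<le> inverse (L_index F))
       \<and> (F \<in> consistently_varying \<longrightarrow>
            (\<forall>\<gamma>>0. (\<lambda>n. SUP x\<in>{\<gamma> * real n..}. ereal \<bar>ratio M X F n x - 1\<bar>) \<longlonglongrightarrow> 0))"
proof -
  interpret prob_space M by fact
  have F: "real_distribution F" and tail_pos: "\<And>x. 0 < tail F x"
    using assms(4) by (auto simp: dominatedly_varying_def)
  obtain C where C: "C > 0" "\<And>n. upper_orthant_dominated M C {1..n} X"
    "\<And>n. upper_orthant_dominated M C {1..n} (\<lambda>i \<omega>. - X i \<omega>)"
    using ENOD_imp_upper_orthant_dominated[OF assms(2)] by blast
  obtain p t0 where dbl: "t0 > 0" "\<And>t. t \<ge> t0 \<Longrightarrow> tail F (t / 2) \<le> 2 ^ p * tail F t"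
    using dominatedly_varying_doubling[OF assms(4)] by blast
  have X1: "X 1 \<in> borel_measurable M" using assms(5) by auto
  have F1: "F = distr M borel (X 1)" using assms(3)[of 1] by simp
  interpret dominated_sums M X F C p t0
  proof (intro dominated_sums.intro dominated_sums_axioms.intro)
    have "integrable (distr M borel (X 1)) (\<lambda>y. y) \<longleftrightarrow> integrable M (X 1)"
      by (rule integrable_distr_eq[OF X1]) simp
    then show "integrable F (\<lambda>y. y)" using assms(5) by (simp only: F1)
    have "(\<integral>y. y \<partial>distr M borel (X 1)) = integral\<^sup>L M (X 1)"
      by (rule integral_distr[OF X1]) simp
    then show "(\<integral>y. y \<partial>F) = 0" using assms(6) by (simp only: F1)
  qed (fact assms(1) F tail_pos C dbl assms(3) assms(7))+
  have L_pos: "0 < L_index F" by (rule L_index_pos[OF F tail_pos dbl(2)])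
  obtain l where l: "L_index F = ereal l" "l > 0"
    using L_pos L_index_le_1[OF F tail_pos] by (cases "L_index F") auto
  show ?thesis
  proof (intro conjI allI impI)
    fix \<gamma> :: real assume "\<gamma> > 0"
    let ?inf = "\<lambda>n. INF x\<in>{\<gamma> * real n..}. ereal (ratio M X F n x)"
    let ?sup = "\<lambda>n. SUP x\<in>{\<gamma> * real n..}. ereal (ratio M X F n x)"
    note bounds = eventually_ratio_bounds[OF l \<open>\<gamma> > 0\<close>]
    show "L_index F \<le> liminf ?inf"
    proof (rule ereal_le_epsilon2)
      fix e :: real assume "e > 0"
      have "ereal (l - e) \<le> liminf ?inf"
        by (rule Liminf_bounded, rule eventually_mono[OF bounds[OF \<open>e > 0\<close>]]) (auto intro!: INF_greatest)
      then have "ereal (l - e) + ereal e \<le> liminf ?inf + ereal e" by (rule add_right_mono)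
      then show "L_index F \<le> liminf ?inf + ereal e" using l by simp
    qed
    have "?inf n \<le> ?sup n" for n
      by (rule order_trans[OF INF_lower SUP_upper]) (rule atLeast_iff[THEN iffD2, OF order_refl])+
    then have "liminf ?inf \<le> liminf ?sup" by (intro Liminf_mono) simp
    also have "\<dots> \<le> limsup ?sup" by (rule Liminf_le_Limsup) simp
    finally show "liminf ?inf \<le> limsup ?sup" .
    show "limsup ?sup \<le> inverse (L_index F)"
    proof (rule ereal_le_epsilon2)
      fix e :: real assume "e > 0"
      have "limsup ?sup \<le> ereal (1 / l + e)"
        by (rule Limsup_bounded, rule eventually_mono[OF bounds[OF \<open>e > 0\<close>]]) (auto intro!: SUP_least)
      then show "limsup ?sup \<le> inverse (L_index F) + ereal e"
        using l by (simp add: inverse_eq_divide)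
    qed
  next
    fix \<gamma> :: real assume "F \<in> consistently_varying" and "\<gamma> > 0"
    then have L1: "L_index F = ereal 1" by (simp add: consistently_varying_def)
    let ?dev = "\<lambda>n. SUP x\<in>{\<gamma> * real n..}. ereal \<bar>ratio M X F n x - 1\<bar>"
    show "?dev \<longlonglongrightarrow> 0"
    proof (rule order_tendstoI)
      fix a :: ereal assume "a < 0"
      have "a < ?dev n" for n
      proof -
        note \<open>a < 0\<close>
        also have "0 \<le> ereal \<bar>ratio M X F n (\<gamma> * real n) - 1\<bar>" by simp
        also have "\<dots> \<le> ?dev n" by (rule SUP_upper) simp
        finally show ?thesis .
      qed
      then show "\<forall>\<^sub>F n in sequentially. a < ?dev n" by simp
    next
      fix a :: ereal assume "0 < a"
      then obtain e where e: "0 < e" "ereal e < a"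
        using ereal_dense2[of 0 a] by auto
      show "\<forall>\<^sub>F n in sequentially. ?dev n < a"
        using eventually_ratio_bounds[OF L1 zero_less_one \<open>\<gamma> > 0\<close> e(1)]
      proof eventually_elim
        case (elim n)
        have "?dev n \<le> ereal e"
          using elim by (intro SUP_least) (auto simp: abs_le_iff)
        then show ?case using e(2) by (rule le_less_trans)
      qed
    qed
  qed
qed

end
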